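(* Suppose Stanley's conjecture holds, i.e. for every $k\ge 1$ and every matroid complex $\mathcal{M}$ of rank $k$, the sequence $(h_1(\mathcal{M}),\dots,h_k(\mathcal{M}))$ of its $h$-numbers is a pure $O$-sequence. Then for every $k\ge1$ and every coloop-free matroid complex $\mathcal{M}$ of rank $k$, the $h$-vector $(h_0,h_1,\dots,h_k)$ of $\mathcal{M}$ satisfies $h_i\le h_j$ whenever $0\le i\le j\le k-i$, and satisfies the $g$-inequalities.
   Context: A simplicial complex on a finite vertex set $V$ is a family of subsets of $V$ closed under taking subsets and containing every singleton $\{x\}$, $x\in V$. The dimension of a face is its cardinality minus one; the rank of the complex is its dimension plus one; it is pure if all maximal faces have the same dimension. A matroid complex is a simplicial complex $\mathcal{M}$ on $V$ such that for every $W\subset V$ the induced subcomplex $\mathcal{M}_W=\{F\in\mathcal{M}:F\subset W\}$ is pure. A vertex $i\in V$ is a coloop if $\mathcal{M}_{V\setminus\{i\}}$ has smaller rank than $\mathcal{M}$; $\mathcal{M}$ is coloop-free if it has no coloop. $h$-vector: if $f_i$ is the number of $i$-dimensional faces of a rank-$k$ complex (with $f_{-1}=1$), then $h_i=\sum_{j=0}^{i}(-1)^{i-j}\binom{k-j}{i-j}f_{j-1}$ for $0\le i\le k$; in particular $h_0=1$. Pure $O$-sequence: a sequence of non-negative integers $(h_1,\dots,h_k)$ with $h_k>0$ for which there exist monomials $m_1,\dots,m_{h_k}$ of degree $k$ in degree-one variables $x_1,\dots,x_{h_1}$ such that, for every $1\le l\le k$, $h_l$ is the number of monomials $m$ of degree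 $l$ in $x_1,\dots,x_{h_1}$ that divide $m_i$ for some $1\le i\le h_k$. $g$-inequalities for $(h_0,\dots,h_k)$: put $g_i=h_i-h_{i-1}$. They assert that $g_i\ge 0$ for $1\le i\le\lfloor k/2\rfloor$, and that for $1\le i<\lfloor k/2\rfloor$, if $g_i=\binom{n_i}{i}+\binom{n_{i-1}}{i-1}+\dots+\binom{n_r}{r}$ with $n_i>n_{i-1}>\dots>n_r\ge r\ge1$ (this expression is unique for $g_i>0$), then $g_{i+1}\le\binom{n_i+1}{i+1}+\binom{n_{i-1}+1}{i}+\dots+\binom{n_r+1}{r+1}$; if $g_i=0$ the bound is $g_{i+1}\le 0$. *)

theory Defs
  imports Complex_Main "HOL-Library.Multiset"
begin

text \<open>
  The empty face is required explicitly (it counts as \<open>f\<^bsub>-1\<^esub> = 1\<close>); it only matters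
  for the empty vertex set.
\<close>

definition simplicial_complex :: "'a set \<Rightarrow> 'a set set \<Rightarrow> bool" where
  "simplicial_complex V M \<longleftrightarrow>
     finite V \<and> M \<subseteq> Pow V \<and> {} \<in> M \<and>
     (\<forall>F\<in>M. \<forall>G. G \<subseteq> F \<longrightarrow> G \<in> M) \<and> (\<forall>x\<in>V. {x} \<in> M)"

definition face_dim :: "'a set \<Rightarrow> int" where
  "face_dim F = int (card F) - 1"

definition complex_dim :: "'a set set \<Rightarrow> int" where
  "complex_dim M = Max (face_dim ` M)"

definition complex_rank :: "'a set set \<Rightarrow> nat" where
  "complex_rank M = nat (complex_dim M + 1)"

definition facets :: "'a set set \<Rightarrow> 'a set set" where
  "facets M = {F \<in> M. \<forall>G\<in>M. F \<subseteq> G \<longrightarrow> F = G}"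

definition pure_complex :: "'a set set \<Rightarrow> bool" where
  "pure_complex M \<longleftrightarrow> (\<forall>F\<in>facets M. \<forall>G\<in>facets M. face_dim F = face_dim G)"

definition induced_subcomplex :: "'a set set \<Rightarrow> 'a set \<Rightarrow> 'a set set" where
  "induced_subcomplex M W = {F \<in> M. F \<subseteq> W}"

definition matroid_complex :: "'a set \<Rightarrow> 'a set set \<Rightarrow> bool" where
  "matroid_complex V M \<longleftrightarrow>
     simplicial_complex V M \<and> (\<forall>W. W \<subseteq> V \<longrightarrow> pure_complex (induced_subcomplex M W))"

definition coloop :: "'a set \<Rightarrow> 'a set set \<Rightarrow> 'a \<Rightarrow> bool" where
  "coloop V M i \<longleftrightarrow>
     i \<in> V \<and> complex_rank (induced_subcomplex M (V - {i})) < complex_rank M"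

definition coloop_free :: "'a set \<Rightarrow> 'a set set \<Rightarrow> bool" where
  "coloop_free V M \<longleftrightarrow> (\<nexists>i. coloop V M i)"

definition f_number :: "'a set set \<Rightarrow> int \<Rightarrow> nat" where
  "f_number M i = card {F \<in> M. face_dim F = i}"

definition h_number :: "'a set set \<Rightarrow> nat \<Rightarrow> int" where
  "h_number M i =
     (\<Sum>j=0..i. (- 1) ^ (i - j) * int ((complex_rank M - j) choose (i - j))
                  * int (f_number M (int j - 1)))"

text \<open>
  A monomial in \<open>x\<^sub>1, \<dots>, x\<^sub>n\<close> is the multiset of the indices of its variables:
  its degree is the size, and divisibility is the submultiset relation.
\<close>

definition monomials :: "nat \<Rightarrow> nat \<Rightarrow> nat multiset set" where
  "monomials n d = {u. set_mset u \<subseteq> {1..n} \<and> size u = d}"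

definition pure_O_sequence :: "nat \<Rightarrow> (nat \<Rightarrow> int) \<Rightarrow> bool" where
  "pure_O_sequence k h \<longleftrightarrow>
     (\<forall>l\<in>{1..k}. 0 \<le> h l) \<and> 0 < h k \<and>
     (\<exists>m :: nat \<Rightarrow> nat multiset.
        (\<forall>i\<in>{1..nat (h k)}. m i \<in> monomials (nat (h 1)) k) \<and>
        (\<forall>l\<in>{1..k}.
           h l = int (card {u \<in> monomials (nat (h 1)) l. \<exists>i\<in>{1..nat (h k)}. u \<subseteq># m i})))"

definition g_number :: "(nat \<Rightarrow> int) \<Rightarrow> nat \<Rightarrow> int" where
  "g_number h i = h i - h (i - 1)"

definition binomial_expansion :: "nat \<Rightarrow> int \<Rightarrow> nat \<Rightarrow> (nat \<Rightarrow> nat) \<Rightarrow> bool" where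
  "binomial_expansion i a r n \<longleftrightarrow>
     1 \<le> r \<and> r \<le> i \<and> r \<le> n r \<and> (\<forall>j\<in>{r..<i}. n j < n (Suc j)) \<and>
     a = int (\<Sum>j=r..i. n j choose j)"

definition g_inequalities :: "nat \<Rightarrow> (nat \<Rightarrow> int) \<Rightarrow> bool" where
  "g_inequalities k h \<longleftrightarrow>
     (\<forall>i\<in>{1..k div 2}. 0 \<le> g_number h i) \<and>
     (\<forall>i\<in>{1..<k div 2}.
        (\<forall>r n. binomial_expansion i (g_number h i) r n \<longrightarrow>
           g_number h (i + 1) \<le> int (\<Sum>j=r..i. (n j + 1) choose (j + 1))) \<and>
        (g_number h i = 0 \<longrightarrow> g_number h (i + 1) \<le> 0))"

text \<open>
  A matroid complex of rank \<open>k\<close> with a coloop has \<open>h\<^sub>k = 0\<close>, whereas a pure O-sequence has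
  \<open>h\<^sub>k > 0\<close>.  Read over all matroid complexes, with the \<open>h\<close>-vector not truncated at its last
  nonzero entry, Stanley's conjecture is therefore refutable, and anything assuming it would
  be vacuous.  Its meaningful form is the one for coloop-free complexes.  Being a special case
  of the unrestricted form, it is the weaker hypothesis.
\<close>

lemma stanley_fails_with_coloops:
  "\<not> (\<forall>k\<ge>1. \<forall>(V :: nat set) M. matroid_complex V M \<and> complex_rank M = k \<longrightarrow>
         pure_O_sequence k (h_number M))"
proof -
  let ?V = "{0::nat}" and ?M = "{{}, {0::nat}}"
  have rank: "complex_rank ?M = 1"
    by (simp add: complex_rank_def complex_dim_def face_dim_def)
  have "facets (induced_subcomplex ?M W) = {W}" if "W \<subseteq> ?V" for W
  proof -
    have "W = {} \<or> W = {0}" using that by blast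
    then show ?thesis by (elim disjE) (auto simp: induced_subcomplex_def facets_def)
  qed
  then have "\<forall>W. W \<subseteq> ?V \<longrightarrow> pure_complex (induced_subcomplex ?M W)"
    by (simp add: pure_complex_def)
  moreover have "simplicial_complex ?V ?M"
    unfolding simplicial_complex_def by (simp add: subset_singleton_iff)
  ultimately have matroid: "matroid_complex ?V ?M"
    unfolding matroid_complex_def by blast
  have "{F \<in> ?M. face_dim F = - 1} = {{}}" "{F \<in> ?M. face_dim F = 0} = {{0}}"
    by (auto simp: face_dim_def)
  then have "h_number ?M 1 = 0"
    by (simp add: h_number_def f_number_def rank)
  then have "\<not> pure_O_sequence 1 (h_number ?M)"
    by (simp add: pure_O_sequence_def)
  with rank matroid show ?thesis by (metis le_refl)
qed

end

theory Submission
  imports Defs "HOL-Library.Multiset_Order"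
begin

text \<open>
  Let \<open>\<Gamma>\<close> be the order ideal of monomials with \<open>h\<^sub>l = card \<Gamma>\<^sub>l\<close>, a union of boxes (sets of divisors
  of a monomial) of degree \<open>k\<close>. On real functions on a box, multiplication by the sum of the
  variables is the raising operator of an \<open>sl\<^sub>2\<close>-representation, so its powers from degree \<open>i\<close> to
  degree \<open>j\<close> are injective for \<open>i \<le> j \<le> k - i\<close>. Restriction to boxes transfers the injectivity to
  \<open>\<Gamma>\<close>, which gives \<open>h\<^sub>i \<le> h\<^sub>j\<close>.

  Dually, for \<open>i \<le> k div 2\<close> the functions on \<open>\<Gamma>\<^sub>i\<close> that are killed by the adjoint operator form a
  space of dimension \<open>g\<^sub>i\<close>, stable under contraction by variables. Their leading monomials form an
  order ideal with \<open>g\<^sub>i\<close> elements in degree \<open>i\<close>, and Macaulay's theorem for order ideals of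
  monomials, proved by compression, bounds \<open>g\<^bsub>i+1\<^esub>\<close>.
\<close>

subsection \<open>The Lefschetz property of boxes\<close>

text \<open>With \<open>f\<close> as coefficient function, this gives the coefficients of
  \<open>f\<close> times the sum of the variables. Ranging over \<open>set_mset\<close> takes each
  variable dividing \<open>v\<close> once, whatever its multiplicity.\<close>

definition raise :: "('a multiset \<Rightarrow> real) \<Rightarrow> 'a multiset \<Rightarrow> real" where
  "raise f v = (\<Sum>x\<in>set_mset v. f (v - {#x#}))"

text \<open>
  The weights make \<open>raise\<close> and \<open>lower m\<close> an \<open>sl\<^sub>2\<close>-pair on the divisors of \<open>m\<close>; they vanish
  where \<open>add_mset x u\<close> would leave the box.
\<close>

definition lower :: "'a multiset \<Rightarrow> ('a multiset \<Rightarrow> real) \<Rightarrow> 'a multiset \<Rightarrow> real" where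
  "lower m f u =
     (\<Sum>x\<in>set_mset m. (real (count u x) + 1) * (real (count m x) - real (count u x)) * f (add_mset x u))"

lemma sum_count_superset:
  assumes "finite X" "set_mset u \<subseteq> X"
  shows "(\<Sum>x\<in>X. real (count u x)) = real (size u)"
proof -
  have "(\<Sum>x\<in>X. real (count u x)) = (\<Sum>x\<in>set_mset u. real (count u x))"
    using assms by (intro sum.mono_neutral_right) (auto simp: count_eq_zero_iff)
  then show ?thesis by (simp add: size_multiset_overloaded_eq)
qed

text \<open>The \<open>sl\<^sub>2\<close> commutator. Terms exchanging two different variables occur
  in both compositions and cancel; a variable with exponents \<open>c\<close> in \<open>u\<close>
  and \<open>a\<close> in \<open>m\<close> leaves
  \<open>(c+1)(a-c) - c(a-c+1) = a - 2c\<close>.\<close>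

lemma lower_raise:
  assumes "set_mset u \<subseteq> set_mset m"
  shows "lower m (raise f) u =
    raise (lower m f) u + (real (size m) - 2 * real (size u)) * f u"
proof -
  define X where "X = set_mset m"
  define S where "S = set_mset u"
  define c where "c x = (real (count u x) + 1) * (real (count m x) - real (count u x))" for x
  \<comment> \<open>The exchange terms, shared by both compositions.\<close>
  define T where "T x y = (if x = y then 0 else c x * f (add_mset x (u - {#y#})))" for x y
  have fin: "finite X" "finite S" "S \<subseteq> X"
    using assms by (auto simp: X_def S_def)
  have up: "raise f (add_mset x u) = f u + (\<Sum>y\<in>S. if x = y then 0 else f (add_mset x (u - {#y#})))" for x
  proof -
    have "raise f (add_mset x u) = f u + (\<Sum>y\<in>S - {x}. f (add_mset x u - {#y#}))"
      unfolding raise_def S_def by (simp add: sum.insert_remove)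
    also have "(\<Sum>y\<in>S - {x}. f (add_mset x u - {#y#})) =
               (\<Sum>y\<in>S - {x}. if x = y then 0 else f (add_mset x (u - {#y#})))"
      by (intro sum.cong) auto
    also have "\<dots> = (\<Sum>y\<in>S. if x = y then 0 else f (add_mset x (u - {#y#})))"
      using fin by (intro sum.mono_neutral_left) auto
    finally show ?thesis .
  qed
  have "lower m (raise f) u = (\<Sum>x\<in>X. c x * f u + (\<Sum>y\<in>S. T x y))"
    unfolding lower_def up X_def c_def[symmetric] T_def
    by (intro sum.cong refl) (auto simp: distrib_left sum_distrib_left intro!: sum.cong)
  then have 1: "lower m (raise f) u = (\<Sum>x\<in>X. c x) * f u + (\<Sum>x\<in>X. \<Sum>y\<in>S. T x y)"
    by (simp add: sum.distrib sum_distrib_right)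
  have down: "lower m f (u - {#y#}) =
      real (count u y) * (real (count m y) - real (count u y) + 1) * f u + (\<Sum>x\<in>X. T x y)"
    if "y \<in> S" for y
  proof -
    have y: "y \<in># u" "y \<in> X" using that fin by (auto simp: S_def)
    then have cnt: "real (count (u - {#y#}) y) = real (count u y) - 1"
      by (simp add: of_nat_diff)
    have "lower m f (u - {#y#}) =
      (real (count (u - {#y#}) y) + 1) * (real (count m y) - real (count (u - {#y#}) y)) * f (add_mset y (u - {#y#}))
      + (\<Sum>x\<in>X - {y}. (real (count (u - {#y#}) x) + 1) * (real (count m x) - real (count (u - {#y#}) x)) * f (add_mset x (u - {#y#})))"
      unfolding lower_def X_def[symmetric] using y fin by (subst sum.remove[of X y]) auto
    also have "(\<Sum>x\<in>X - {y}. (real (count (u - {#y#}) x) + 1) * (real (count m x) - real (count (u - {#y#}) x)) * f (add_mset x (u - {#y#})))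
       = (\<Sum>x\<in>X - {y}. T x y)"
      by (intro sum.cong) (auto simp: T_def c_def)
    also have "\<dots> = (\<Sum>x\<in>X. T x y)"
      using fin by (intro sum.mono_neutral_left) (auto simp: T_def)
    finally show ?thesis using y by (simp only: cnt) (simp add: algebra_simps)
  qed
  have "raise (lower m f) u = (\<Sum>y\<in>S. real (count u y) * (real (count m y) - real (count u y) + 1) * f u + (\<Sum>x\<in>X. T x y))"
    unfolding raise_def S_def[symmetric] using down by (intro sum.cong) auto
  also have "\<dots> = (\<Sum>y\<in>S. real (count u y) * (real (count m y) - real (count u y) + 1)) * f u + (\<Sum>y\<in>S. \<Sum>x\<in>X. T x y)"
    by (simp add: sum.distrib sum_distrib_right)
  also have "(\<Sum>y\<in>S. real (count u y) * (real (count m y) - real (count u y) + 1))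
     = (\<Sum>y\<in>X. real (count u y) * (real (count m y) - real (count u y) + 1))"
    using fin by (intro sum.mono_neutral_left) (auto simp: S_def count_eq_zero_iff)
  also have "(\<Sum>y\<in>S. \<Sum>x\<in>X. T x y) = (\<Sum>x\<in>X. \<Sum>y\<in>S. T x y)"
    by (rule sum.swap)
  finally have 2: "raise (lower m f) u =
    (\<Sum>y\<in>X. real (count u y) * (real (count m y) - real (count u y) + 1)) * f u + (\<Sum>x\<in>X. \<Sum>y\<in>S. T x y)" .
  have "(\<Sum>x\<in>X. c x) = (\<Sum>y\<in>X. real (count u y) * (real (count m y) - real (count u y) + 1)
      + (real (count m y) - 2 * real (count u y)))"
    by (intro sum.cong) (auto simp: c_def algebra_simps)
  also have "\<dots> = (\<Sum>y\<in>X. real (count u y) * (real (count m y) - real (count u y) + 1))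
      + (real (size m) - 2 * real (size u))"
    using sum_count_superset[of X m] sum_count_superset[of X u] fin
    by (simp add: sum.distrib sum_subtractf sum_distrib_left[symmetric] X_def S_def)
  finally show ?thesis unfolding 1 2 by (simp add: distrib_right)
qed

text \<open>Iterating the commutator adds the weights \<open>size m - 2 (d + q)\<close> for
  \<open>q = 0, ..., p\<close>, an arithmetic progression. Here \<open>d\<close> is the degree in
  which \<open>f\<close> is sampled.\<close>

lemma lower_raise_funpow:
  assumes "set_mset u \<subseteq> set_mset m" "size u = d + p"
  shows "lower m ((raise ^^ Suc p) f) u = (raise ^^ Suc p) (lower m f) u +
    real (Suc p) * (real (size m) - 2 * real d - real p) * (raise ^^ p) f u"
  using assms
proof (induction p arbitrary: u)
  case 0
  then show ?case by (simp add: lower_raise)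
next
  case (Suc p)
  let ?k = "real (size m)" and ?g = "(raise ^^ Suc p) f"
  have "raise (lower m ?g) u = (\<Sum>x\<in>set_mset u. (raise ^^ Suc p) (lower m f) (u - {#x#}) +
    real (Suc p) * (?k - 2 * real d - real p) * (raise ^^ p) f (u - {#x#}))"
    unfolding raise_def[of "lower m ?g"]
  proof (intro sum.cong refl)
    fix x assume "x \<in> set_mset u"
    with Suc.prems show "lower m ?g (u - {#x#}) = (raise ^^ Suc p) (lower m f) (u - {#x#}) +
      real (Suc p) * (?k - 2 * real d - real p) * (raise ^^ p) f (u - {#x#})"
      by (intro Suc.IH) (auto simp: size_Diff_singleton dest: in_diffD)
  qed
  also have "\<dots> = raise ((raise ^^ Suc p) (lower m f)) u +
      real (Suc p) * (?k - 2 * real d - real p) * raise ((raise ^^ p) f) u"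
    unfolding raise_def[of "(raise ^^ Suc p) (lower m f)"] raise_def[of "(raise ^^ p) f"]
    by (simp only: sum.distrib sum_distrib_left)
  finally have "raise (lower m ?g) u = (raise ^^ Suc (Suc p)) (lower m f) u +
      real (Suc p) * (?k - 2 * real d - real p) * ?g u"
    by (simp only: funpow.simps o_def)
  moreover have "lower m (raise ?g) u = raise (lower m ?g) u + (?k - 2 * real (size u)) * ?g u"
    using Suc.prems(1) by (rule lower_raise)
  ultimately have "lower m (raise ?g) u = (raise ^^ Suc (Suc p)) (lower m f) u +
      (real (Suc p) * (?k - 2 * real d - real p) + (?k - 2 * real (size u))) * ?g u"
    by (simp only: distrib_right add.assoc)
  also have "real (Suc p) * (?k - 2 * real d - real p) + (?k - 2 * real (size u))
     = real (Suc (Suc p)) * (?k - 2 * real d - real (Suc p))"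
    using Suc.prems(2) by (simp add: algebra_simps)
  finally show ?case by simp
qed

lemma raise_funpow_eq_0:
  assumes "\<And>u. u \<subseteq># v \<Longrightarrow> size u + p = size v \<Longrightarrow> g u = 0"
  shows "(raise ^^ p) g v = 0"
  using assms
proof (induction p arbitrary: v)
  case 0
  then show ?case by simp
next
  case (Suc p)
  have "(raise ^^ p) g (v - {#x#}) = 0" if "x \<in># v" for x
  proof (rule Suc.IH)
    fix u assume u: "u \<subseteq># v - {#x#}" "size u + p = size (v - {#x#})"
    have "size v > 0" using that by (metis nonempty_has_size empty_not_add_mset multi_member_split)
    with u that show "g u = 0"
      by (intro Suc.prems) (auto simp: size_Diff_singleton intro: subset_mset.order_trans[OF _ diff_subset_eq_self])
  qed
  then show ?case by (simp add: raise_def[of "(raise ^^ p) g"])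
qed

lemma lower_eq_0:
  assumes "u \<subseteq># m" "\<And>v. v \<subseteq># m \<Longrightarrow> size v = Suc (size u) \<Longrightarrow> f v = 0"
  shows "lower m f u = 0"
  unfolding lower_def
proof (intro sum.neutral ballI)
  fix x assume "x \<in># m"
  show "(real (count u x) + 1) * (real (count m x) - real (count u x)) * f (add_mset x u) = 0"
  proof (cases "count u x < count m x")
    case True
    then have "add_mset x u \<subseteq># m"
      using assms(1) by (auto simp: subseteq_mset_def)
    then show ?thesis using assms(2)[of "add_mset x u"] by simp
  next
    case False
    then have "count u x = count m x"
      using assms(1) by (meson le_neq_implies_less mset_subset_eq_count)
    then show ?thesis by simp
  qed
qed

text \<open>Outer induction on the degree, inner on the power. If \<open>raise ^^ Suc p\<close>
  kills \<open>f\<close>, the commutator shows that \<open>raise ^^ Suc (Suc p)\<close> kills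
  \<open>lower m f\<close>, which thus vanishes by the outer hypothesis. The commutator then leaves
  a multiple of \<open>(raise ^^ p) f\<close>, with positive coefficient since
  \<open>Suc p + 2 * d \<le> size m\<close>.\<close>

lemma raise_funpow_inj_box:
  assumes "p + 2 * d \<le> size m"
    and "\<And>v. v \<subseteq># m \<Longrightarrow> size v = d + p \<Longrightarrow> (raise ^^ p) f v = 0"
    and "u \<subseteq># m" "size u = d"
  shows "f u = 0"
  using assms
proof (induction d arbitrary: p f u rule: less_induct)
  case (less d)
  show ?case using less.prems
  proof (induction p)
    case 0
    then show ?case by simp
  next
    case (Suc p)
    have Ff: "lower m f w = 0" if w: "w \<subseteq># m" "Suc (size w) = d" for w
    proof (rule less.IH[of "size w" "Suc (Suc p)"])
      fix v assume v: "v \<subseteq># m" "size v = size w + Suc (Suc p)"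
      have "lower m ((raise ^^ Suc (Suc p)) f) v = 0"
      proof (rule lower_eq_0[OF v(1)])
        fix v' assume v': "v' \<subseteq># m" "size v' = Suc (size v)"
        have "(raise ^^ Suc p) f (v' - {#x#}) = 0" if "x \<in># v'" for x
          using that v v' w
          by (intro Suc.prems(2)) (auto simp: size_Diff_singleton intro: subset_mset.order_trans[OF diff_subset_eq_self])
        then show "(raise ^^ Suc (Suc p)) f v' = 0"
          by (simp add: raise_def)
      qed
      moreover have "(raise ^^ Suc p) f v = 0"
        using v w by (intro Suc.prems(2)) auto
      ultimately show "(raise ^^ Suc (Suc p)) (lower m f) v = 0"
        using lower_raise_funpow[of v m d "Suc p" f] v w
        by (simp add: set_mset_mono)
    qed (use w Suc.prems in auto)
    show ?case
    proof (rule Suc.IH)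
      fix v assume v: "v \<subseteq># m" "size v = d + p"
      have "lower m ((raise ^^ Suc p) f) v = 0"
        using v by (intro lower_eq_0 Suc.prems(2)) auto
      moreover have "(raise ^^ Suc p) (lower m f) v = 0"
        using v by (intro raise_funpow_eq_0 Ff) (auto intro: subset_mset.order_trans)
      ultimately have "real (Suc p) * (real (size m) - 2 * real d - real p) * (raise ^^ p) f v = 0"
        using lower_raise_funpow[of v m d p f] v by (simp add: set_mset_mono)
      moreover have "real (size m) - 2 * real d - real p > 0"
        using Suc.prems(1) by linarith
      ultimately show "(raise ^^ p) f v = 0" by simp
    qed (use Suc.prems in auto)
  qed
qed

subsection \<open>Compression of families of multisets\<close>

definition shadow :: "'a multiset set \<Rightarrow> 'a multiset set" where
  "shadow F = {v - {#x#} |v x. v \<in> F \<and> x \<in># v}"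

definition merge :: "'a \<Rightarrow> 'a \<Rightarrow> 'a multiset \<Rightarrow> 'a multiset" where
  "merge x y v = filter_mset (\<lambda>z. z \<noteq> x) v + replicate_mset (count v x) y"

definition fibre :: "'a \<Rightarrow> 'a \<Rightarrow> 'a multiset set \<Rightarrow> 'a multiset \<Rightarrow> 'a multiset set" where
  "fibre x y F k = {v \<in> F. merge x y v = k}"

text \<open>
  \<open>merge x y\<close> forgets how the \<open>x\<close>'s and \<open>y\<close>'s are distributed; compression replaces each fibre
  by the equally many multisets with the fewest \<open>y\<close>'s.
\<close>

definition compress :: "'a \<Rightarrow> 'a \<Rightarrow> 'a multiset set \<Rightarrow> 'a multiset set" where
  "compress x y F = {v. count v y < card (fibre x y F (merge x y v))}"

text \<open>For \<open>c\<close> at most \<open>count v x + count v y\<close>, the unique member of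
  the \<open>merge\<close> class of \<open>v\<close> with \<open>c\<close> copies of
  \<open>y\<close>.\<close>

definition redistribute :: "'a \<Rightarrow> 'a \<Rightarrow> 'a multiset \<Rightarrow> nat \<Rightarrow> 'a multiset" where
  "redistribute x y v c = filter_mset (\<lambda>z. z \<noteq> x \<and> z \<noteq> y) v + replicate_mset c y
     + replicate_mset (count v x + count v y - c) x"

text \<open>The position of \<open>v\<close> in its fibre ordered by multiplicity of
  \<open>y\<close>; it becomes the number of \<open>y\<close>'s after compression.\<close>

definition fibre_rank :: "'a \<Rightarrow> 'a \<Rightarrow> 'a multiset set \<Rightarrow> 'a multiset \<Rightarrow> nat" where
  "fibre_rank x y F v = card {w \<in> fibre x y F (merge x y v). count w y < count v y}"

text \<open>Only one variable \<open>x\<close> is favoured, because the induction for Macaulay's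
  theorem removes one variable at a time.\<close>

definition shift_stable :: "'a \<Rightarrow> 'a multiset set \<Rightarrow> bool" where
  "shift_stable x F \<longleftrightarrow> (\<forall>v\<in>F. \<forall>y\<in>#v. add_mset x (v - {#y#}) \<in> F)"

lemma shadow_eq_UN: "shadow F = (\<Union>v\<in>F. (\<lambda>x. v - {#x#}) ` set_mset v)"
  by (auto simp: shadow_def)

section \<open>Shadows, merge classes and fibre ranks\<close>

lemma finite_shadow: "finite F \<Longrightarrow> finite (shadow F)"
  by (simp add: shadow_eq_UN)

lemma shadowI: "v \<in> F \<Longrightarrow> x \<in># v \<Longrightarrow> v - {#x#} \<in> shadow F"
  by (auto simp: shadow_def)

lemma shadow_multisets_of_size:
  assumes "F \<subseteq> multisets_of_size X (Suc d)"
  shows "shadow F \<subseteq> multisets_of_size X d"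
proof
  fix u assume "u \<in> shadow F"
  then obtain v x where v: "v \<in> F" "x \<in># v" "u = v - {#x#}" by (auto simp: shadow_def)
  then have "set_mset v \<subseteq> X" "size v = Suc d" using assms by (auto simp: multisets_of_size_def)
  then show "u \<in> multisets_of_size X d"
    using v by (auto simp: multisets_of_size_def size_Diff_singleton dest: in_diffD)
qed

lemma count_merge:
  "x \<noteq> y \<Longrightarrow> count (merge x y v) z =
     (if z = x then 0 else if z = y then count v x + count v y else count v z)"
  by (auto simp: merge_def)

lemma size_merge: "size (merge x y v) = size v"
proof -
  have "size v = size (filter_mset (\<lambda>z. z \<noteq> x) v + filter_mset (\<lambda>z. \<not> z \<noteq> x) v)"
    by (simp only: multiset_partition[symmetric])
  also have "filter_mset (\<lambda>z. \<not> z \<noteq> x) v = replicate_mset (count v x) x"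
    by (simp add: filter_eq_replicate_mset)
  finally show ?thesis by (simp add: merge_def)
qed

lemma merge_eq_imp_eq:
  assumes "x \<noteq> y" "merge x y v = merge x y w" "count v y = count w y"
  shows "v = w"
proof (rule multiset_eqI)
  fix z
  have "count (merge x y v) t = count (merge x y w) t" for t using assms by simp
  from this[of z] this[of y] show "count v z = count w z"
    using assms(1,3) by (cases "z = x"; cases "z = y") (simp_all add: count_merge)
qed

lemma merge_diff:
  assumes "x \<noteq> y" "z \<in># v"
  shows "merge x y (v - {#z#}) = merge x y v - {#if z = x then y else z#}"
proof (rule multiset_eqI)
  fix t
  show "count (merge x y (v - {#z#})) t = count (merge x y v - {#if z = x then y else z#}) t"
    using assms by (auto simp: count_merge simp flip: count_greater_zero_iff)
qed

lemma merge_redistribute: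
  assumes "x \<noteq> y" "c \<le> count v x + count v y"
  shows "merge x y (redistribute x y v c) = merge x y v"
  by (rule multiset_eqI) (use assms in \<open>auto simp: count_merge redistribute_def\<close>)

lemma count_redistribute:
  assumes "x \<noteq> y"
  shows "count (redistribute x y v c) y = c"
    and "count (redistribute x y v c) x = count v x + count v y - c"
  using assms by (auto simp: redistribute_def)

lemma inj_on_count_fibre: "x \<noteq> y \<Longrightarrow> inj_on (\<lambda>v. count v y) (fibre x y F k)"
  unfolding inj_on_def fibre_def using merge_eq_imp_eq[of x y] by blast

lemma finite_fibre: "finite F \<Longrightarrow> finite (fibre x y F k)"
  by (simp add: fibre_def)

lemma fibre_rank_le_card:
  assumes "x \<noteq> y" "finite F" "\<And>w. w \<in> fibre x y F (merge x y v) \<Longrightarrow> count w y < count v y \<Longrightarrow> count w y \<in> A"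
    "finite A"
  shows "fibre_rank x y F v \<le> card A"
  unfolding fibre_rank_def
proof (rule card_inj_on_le[of "\<lambda>w. count w y"])
  show "inj_on (\<lambda>w. count w y) {w \<in> fibre x y F (merge x y v). count w y < count v y}"
    by (rule inj_on_subset[OF inj_on_count_fibre[OF assms(1), of F "merge x y v"]]) blast
qed (use assms in auto)

lemma fibre_rank_le: "x \<noteq> y \<Longrightarrow> finite F \<Longrightarrow> fibre_rank x y F v \<le> count v y"
  using fibre_rank_le_card[of x y F v "{..<count v y}"] by simp

lemma fibre_rank_strict_mono:
  assumes "finite F" "v \<in> F" "merge x y v = merge x y w" "count v y < count w y"
  shows "fibre_rank x y F v < fibre_rank x y F w"
  unfolding fibre_rank_def
  by (rule psubset_card_mono) (use assms in \<open>auto simp: fibre_def\<close>)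

text \<open>Within a fibre the rank increases strictly with the multiplicity of \<open>y\<close>,
  hence is injective, and counting shows that it fills the initial segment.\<close>

lemma bij_betw_fibre_rank:
  assumes "x \<noteq> y" "finite F"
  shows "bij_betw (fibre_rank x y F) (fibre x y F k) {..<card (fibre x y F k)}"
proof -
  have inj: "inj_on (fibre_rank x y F) (fibre x y F k)"
  proof (rule inj_onI)
    fix v w assume vw: "v \<in> fibre x y F k" "w \<in> fibre x y F k" "fibre_rank x y F v = fibre_rank x y F w"
    then have "\<not> count v y < count w y" "\<not> count w y < count v y"
      using fibre_rank_strict_mono[OF assms(2), of v x y w] fibre_rank_strict_mono[OF assms(2), of w x y v]
      by (auto simp: fibre_def)
    then show "v = w" using vw assms(1) by (auto simp: fibre_def intro: merge_eq_imp_eq)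
  qed
  have "fibre_rank x y F v < card (fibre x y F k)" if "v \<in> fibre x y F k" for v
    unfolding fibre_rank_def
    by (rule psubset_card_mono) (use that assms in \<open>auto simp: fibre_def\<close>)
  then have "fibre_rank x y F ` fibre x y F k \<subseteq> {..<card (fibre x y F k)}" by auto
  moreover have "card (fibre_rank x y F ` fibre x y F k) = card (fibre x y F k)"
    using inj by (rule card_image)
  ultimately have "fibre_rank x y F ` fibre x y F k = {..<card (fibre x y F k)}"
    by (intro card_subset_eq) auto
  with inj show ?thesis by (simp add: bij_betw_def)
qed

lemma bij_betw_compress:
  assumes xy: "x \<noteq> y" and F: "finite F"
  shows "bij_betw (\<lambda>v. redistribute x y v (fibre_rank x y F v)) F (compress x y F)"
proof -
  let ?r = "fibre_rank x y F" and ?b = "\<lambda>v. redistribute x y v (fibre_rank x y F v)"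
  have merge_b: "merge x y (?b v) = merge x y v" for v
    using xy fibre_rank_le[OF xy F, of v] by (intro merge_redistribute) auto
  have count_b: "count (?b v) y = ?r v" for v
    using xy by (rule count_redistribute)
  show ?thesis
  proof (rule bij_betw_imageI)
    show "inj_on ?b F"
    proof (rule inj_onI)
      fix v w assume vw: "v \<in> F" "w \<in> F" "?b v = ?b w"
      then have "v \<in> fibre x y F (merge x y v)" "w \<in> fibre x y F (merge x y v)" "?r v = ?r w"
        using merge_b[of v] merge_b[of w] count_b[of v] count_b[of w] by (auto simp: fibre_def)
      then show "v = w"
        using inj_onD[OF bij_betw_imp_inj_on[OF bij_betw_fibre_rank[OF xy F, of "merge x y v"]]] by blast
    qed
    show "?b ` F = compress x y F"
    proof (intro equalityI subsetI)
      fix u assume "u \<in> ?b ` F"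
      then obtain v where v: "v \<in> F" "u = ?b v" by auto
      then have "?r v \<in> {..<card (fibre x y F (merge x y v))}"
        by (intro bij_betw_apply[OF bij_betw_fibre_rank[OF xy F]]) (simp add: fibre_def)
      then show "u \<in> compress x y F"
        using v merge_b count_b by (simp add: compress_def)
    next
      fix u assume "u \<in> compress x y F"
      then have "count u y \<in> {..<card (fibre x y F (merge x y u))}"
        by (simp add: compress_def)
      then obtain v where v: "v \<in> fibre x y F (merge x y u)" "?r v = count u y"
        using bij_betw_fibre_rank[OF xy F, of "merge x y u"] by (metis bij_betw_imp_surj_on imageE)
      have "u = ?b v"
      proof (rule merge_eq_imp_eq[OF xy])
        show "merge x y u = merge x y (?b v)"
          using v(1) unfolding merge_b by (simp add: fibre_def)
        show "count u y = count (?b v) y"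
          using v(2) unfolding count_b by simp
      qed
      moreover have "v \<in> F" using v(1) by (simp add: fibre_def)
      ultimately show "u \<in> ?b ` F" by (rule image_eqI)
    qed
  qed
qed

text \<open>Compared fibre by fibre. Deleting a third variable embeds a fibre into one of the
  shadow. Deleting \<open>x\<close> or \<open>y\<close> leads to one common fibre, with at least
  \<open>card A - 1\<close> members, and at least \<open>card A\<close> if \<open>A\<close> misses a
  member of its class.\<close>

lemma shadow_compress_subset:
  assumes xy: "x \<noteq> y" and F: "finite F"
  shows "shadow (compress x y F) \<subseteq> compress x y (shadow F)"
proof
  fix u assume "u \<in> shadow (compress x y F)"
  then obtain v z where u: "u = v - {#z#}" and v: "v \<in> compress x y F" and z: "z \<in># v"
    by (auto simp: shadow_def)
  define k where "k = merge x y v"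
  define A where "A = fibre x y F k"
  have cA: "count v y < card A" using v by (simp add: compress_def A_def k_def)
  have finA: "finite A" using F by (simp add: A_def finite_fibre)
  have A: "w \<in> F" "merge x y w = k" if "w \<in> A" for w using that by (auto simp: A_def fibre_def)
  have fins: "finite (fibre x y (shadow F) k')" for k'
    using F by (intro finite_fibre finite_shadow)
  have A_total: "count w x + count w y = count v x + count v y" if "w \<in> A" for w
  proof -
    have "count (merge x y w) y = count (merge x y v) y" using A(2)[OF that] by (simp add: k_def)
    then show ?thesis using xy by (simp add: count_merge)
  qed
  have A_eq: "w = w'" if "w \<in> A" "w' \<in> A" "count w y = count w' y" for w w'
    using that A xy by (metis merge_eq_imp_eq)
  have remove: "w - {#t#} \<in> fibre x y (shadow F) (k - {#if t = x then y else t#})"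
    if "w \<in> A" "t \<in># w" for w t
    using that A[of w] merge_diff[OF xy, of t w] by (auto simp: fibre_def intro: shadowI)
  have k': "merge x y u = k - {#if z = x then y else z#}"
    using z xy by (simp add: u merge_diff k_def)
  \<comment> \<open>Only one member of a class has no \<open>y\<close>; deleting \<open>y\<close> is
    injective on the others.\<close>
  have del_y: "card A - 1 \<le> card (fibre x y (shadow F) (k - {#y#}))"
  proof -
    let ?B = "{w \<in> A. y \<in># w}"
    have "card (A - ?B) \<le> 1"
    proof -
      have "w = w'" if "w \<in> A - ?B" "w' \<in> A - ?B" for w w'
        using that by (intro A_eq) (auto simp: not_in_iff)
      then have "card (A - ?B) \<le> Suc 0"
        by (subst card_le_Suc0_iff_eq) (use finA in blast)+
      then show ?thesis by simp
    qed
    then have "card A - 1 \<le> card ?B"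
      using finA by (subst (asm) card_Diff_subset) auto
    also have "card ?B \<le> card (fibre x y (shadow F) (k - {#y#}))"
    proof (rule card_inj_on_le[of "\<lambda>w. w - {#y#}"])
      show "inj_on (\<lambda>w. w - {#y#}) ?B"
        by (auto simp: inj_on_def dest: insert_DiffM)
      show "(\<lambda>w. w - {#y#}) ` ?B \<subseteq> fibre x y (shadow F) (k - {#y#})"
        using remove[of _ y] xy by auto
    qed (rule fins)
    finally show ?thesis .
  qed
  have "count u y < card (fibre x y (shadow F) (merge x y u))"
  proof (cases "z = x \<or> z = y")
    case False
    have "card A \<le> card (fibre x y (shadow F) (k - {#z#}))"
    proof (rule card_inj_on_le[of "\<lambda>w. w - {#z#}"])
      have zA: "z \<in># w" if "w \<in> A" for w
      proof -
        have "count (merge x y w) z = count (merge x y v) z" using A(2)[OF that] by (simp add: k_def)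
        then show ?thesis using False xy z by (simp add: count_merge flip: count_greater_zero_iff)
      qed
      show "inj_on (\<lambda>w. w - {#z#}) A"
        using zA by (auto simp: inj_on_def) (metis insert_DiffM)
      show "(\<lambda>w. w - {#z#}) ` A \<subseteq> fibre x y (shadow F) (k - {#z#})"
        using remove[of _ z] zA False by auto
    qed (rule fins)
    then show ?thesis using cA k' False by (simp add: u)
  next
    case True
    then have k'': "merge x y u = k - {#y#}" using k' by auto
    show ?thesis
    \<comment> \<open>Here \<open>card A - 1\<close> members suffice: either \<open>u\<close> has
      one \<open>y\<close> fewer than \<open>v\<close>, or \<open>v\<close> is not the last member
      of its compressed fibre.\<close>
    proof (cases "z = y \<or> count v y + 1 < card A")
      case True
      then have "count u y < card A - 1"
      proof
        assume "z = y"
        then have "count v y > 0" "count u y = count v y - 1" using z u by auto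
        then show ?thesis using cA by linarith
      next
        assume "count v y + 1 < card A"
        moreover have "count u y \<le> count v y" using u by simp
        ultimately show ?thesis by linarith
      qed
      then show ?thesis using del_y k'' by simp
    next
      case False
      with \<open>z = x \<or> z = y\<close> cA have zx: "z = x" and card: "card A = Suc (count v y)" by auto
      \<comment> \<open>A class with \<open>e\<close> copies of \<open>x\<close> and
        \<open>y\<close> has \<open>e + 1\<close> members. As \<open>x\<close> occurs in
        \<open>v\<close>, \<open>card A = Suc (count v y) \<le> e\<close>, so \<open>A\<close> is
        not full.\<close>
      define e where "e = count v x + count v y"
      \<comment> \<open>The fibre misses some number \<open>m\<close> of \<open>y\<close>'s; deleting \<open>x\<close> below the gap and \<open>y\<close> above it is injective.\<close>
      have "card ((\<lambda>w. count w y) ` A) < card {..e}"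
        using z zx card_image_le[OF finA, of "\<lambda>w. count w y"] card
        by (simp add: e_def flip: count_greater_zero_iff)
      then obtain m where m: "m \<le> e" "m \<notin> (\<lambda>w. count w y) ` A"
        by (metis atMost_iff card_mono finA finite_imageI leD subsetI)
      let ?d = "\<lambda>w. w - {#if count w y < m then x else y#}"
      \<comment> \<open>Below the gap, \<open>count w y < m \<le> e\<close> leaves an
        \<open>x\<close> to delete; otherwise \<open>count w y > m\<close> leaves a
        \<open>y\<close>.\<close>
      have mem: "(if count w y < m then x else y) \<in># w" if "w \<in> A" for w
        using A_total[OF that] m that by (auto simp: e_def simp flip: count_greater_zero_iff)
      have cnt: "count (?d w) y = (if count w y < m then count w y else count w y - 1)" for w
        using xy by auto
      have "card A \<le> card (fibre x y (shadow F) (k - {#y#}))"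
      proof (rule card_inj_on_le[of ?d])
        show "inj_on ?d A"
        proof (rule inj_onI)
          fix w w' assume w: "w \<in> A" "w' \<in> A" "?d w = ?d w'"
          then have "(if count w y < m then count w y else count w y - 1) =
              (if count w' y < m then count w' y else count w' y - 1)"
            by (metis cnt)
          moreover have "count w y \<noteq> m" "count w' y \<noteq> m" using w m by auto
          ultimately have "count w y = count w' y" by (auto split: if_splits)
          then show "w = w'" using w by (intro A_eq)
        qed
        show "?d ` A \<subseteq> fibre x y (shadow F) (k - {#y#})"
        proof
          fix t assume "t \<in> ?d ` A"
          then obtain w where w: "w \<in> A" "t = ?d w" by auto
          show "t \<in> fibre x y (shadow F) (k - {#y#})"
            using remove[OF w(1) mem[OF w(1)]] xy w(2) by (cases "count w y < m") auto
        qed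
      qed (rule fins)
      then show ?thesis using k'' card zx xy u by simp
    qed
  qed
  then show "u \<in> compress x y (shadow F)" by (simp add: compress_def)
qed

lemma compress_multisets_of_size:
  assumes "x \<noteq> y" "x \<in> X" "y \<in> X" "F \<subseteq> multisets_of_size X d"
  shows "compress x y F \<subseteq> multisets_of_size X d"
proof
  fix v assume "v \<in> compress x y F"
  then have "fibre x y F (merge x y v) \<noteq> {}" by (auto simp: compress_def)
  then obtain w where w: "w \<in> F" "merge x y w = merge x y v" by (auto simp: fibre_def)
  then have size: "size v = d" "set_mset w \<subseteq> X"
    using assms(4) size_merge[of x y w] size_merge[of x y v] by (auto simp: multisets_of_size_def)
  have "z \<in> X" if "z \<in># v" for z
  proof (cases "z = x \<or> z = y")
    case False
    then have "count w z = count v z" using w(2) assms(1) by (metis count_merge)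
    then have "z \<in># w" using that by (simp flip: count_greater_zero_iff)
    then show ?thesis using size by auto
  qed (use assms in auto)
  then show "v \<in> multisets_of_size X d" using size by (auto simp: multisets_of_size_def)
qed

text \<open>Among the finitely many families of the same size with no larger shadow, take one with
  the greatest total multiplicity of \<open>x\<close>. At a failure of stability, compression would
  increase that total.\<close>

lemma exists_stable:
  assumes X: "finite X" "x \<in> X" and U: "U \<subseteq> multisets_of_size X d"
  obtains U' where "U' \<subseteq> multisets_of_size X d" "card U' = card U"
    "card (shadow U') \<le> card (shadow U)" "shift_stable x U'"
proof -
  define C where "C = {U'. U' \<subseteq> multisets_of_size X d \<and> card U' = card U \<and> card (shadow U') \<le> card (shadow U)}"
  define \<phi> where "\<phi> U' = (\<Sum>v\<in>U'. count v x)" for U'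
  have fin: "finite (multisets_of_size X d)" using X by blast
  then have "finite C" by (intro finite_subset[of C "Pow (multisets_of_size X d)"]) (auto simp: C_def)
  moreover have "U \<in> C" using U by (simp add: C_def)
  ultimately have "Max (\<phi> ` C) \<in> \<phi> ` C" by (intro Max_in) auto
  then obtain U' where U': "U' \<in> C" "\<phi> U' = Max (\<phi> ` C)" by auto
  have max: "\<phi> W \<le> \<phi> U'" if "W \<in> C" for W
    using that \<open>finite C\<close> by (simp add: U'(2))
  have finU': "finite U'" using U' fin by (auto simp: C_def intro: finite_subset)
  have "shift_stable x U'"
    unfolding shift_stable_def
  proof (intro ballI, rule ccontr)
    fix v y assume v: "v \<in> U'" "y \<in># v" "add_mset x (v - {#y#}) \<notin> U'"
    then have xy: "x \<noteq> y" by auto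
    have y: "y \<in> X" using v U' by (auto simp: C_def multisets_of_size_def)
    let ?W = "compress x y U'"
    note bij = bij_betw_compress[OF xy finU']
    have "card (shadow ?W) \<le> card (compress x y (shadow U'))"
      using bij_betw_compress[OF xy finite_shadow[OF finU']] finite_shadow[OF finU']
      by (intro card_mono shadow_compress_subset xy finU') (auto dest: bij_betw_finite)
    also have "\<dots> = card (shadow U')"
      using bij_betw_compress[OF xy finite_shadow[OF finU']] by (simp add: bij_betw_same_card)
    finally have "?W \<in> C"
      using U' compress_multisets_of_size[OF xy X(2) y, of U' d] bij_betw_same_card[OF bij]
      by (auto simp: C_def)
    have "\<phi> U' < (\<Sum>w\<in>U'. count (redistribute x y w (fibre_rank x y U' w)) x)"
      unfolding \<phi>_def
    proof (rule sum_strict_mono_ex1[OF finU'])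
      show "\<forall>w\<in>U'. count w x \<le> count (redistribute x y w (fibre_rank x y U' w)) x"
      proof
        fix w
        show "count w x \<le> count (redistribute x y w (fibre_rank x y U' w)) x"
          using fibre_rank_le[OF xy finU', of w] by (simp add: count_redistribute[OF xy])
      qed
      have "fibre_rank x y U' v \<le> card ({..<count v y} - {count v y - 1})"
      proof (rule fibre_rank_le_card[OF xy finU'])
        fix w assume w: "w \<in> fibre x y U' (merge x y v)" "count w y < count v y"
        have "w \<noteq> add_mset x (v - {#y#})" using v w by (auto simp: fibre_def)
        moreover have "merge x y (add_mset x (v - {#y#})) = merge x y v"
          by (rule multiset_eqI) (use xy v in \<open>auto simp: count_merge simp flip: count_greater_zero_iff\<close>)
        ultimately have "count w y \<noteq> count v y - 1"
          using w xy merge_eq_imp_eq[OF xy, of w "add_mset x (v - {#y#})"]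
          by (auto simp: fibre_def)
        then show "count w y \<in> {..<count v y} - {count v y - 1}" using w by auto
      qed simp
      also have "\<dots> < count v y" using v by (simp flip: count_greater_zero_iff)
      finally show "\<exists>w\<in>U'. count w x < count (redistribute x y w (fibre_rank x y U' w)) x"
        using v by (intro bexI[of _ v]) (auto simp: count_redistribute[OF xy])
    qed
    also have "\<dots> = \<phi> ?W"
      unfolding \<phi>_def by (rule sum.reindex_bij_betw[OF bij])
    finally show False using max[OF \<open>?W \<in> C\<close>] by simp
  qed
  then show ?thesis using that U' by (auto simp: C_def)
qed

subsection \<open>Macaulay's theorem\<close>

text \<open>
  The number of monomials of degree \<open>j\<close> in \<open>e\<close> variables. A binomial expansion with top entries
  \<open>n\<^sub>j\<close> is \<open>\<Sum>j=1..d. monomial_number (e j) j\<close> with \<open>e j = n\<^sub>j - j + 1\<close>, and \<open>e j = 0\<close> below the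
  expansion.
\<close>

definition monomial_number :: "nat \<Rightarrow> nat \<Rightarrow> nat" where
  "monomial_number e j = (e + j - 1) choose j"

definition link :: "'a \<Rightarrow> 'a multiset set \<Rightarrow> 'a multiset set" where
  "link x F = {w. add_mset x w \<in> F}"

lemma monomial_number_0: "1 \<le> j \<Longrightarrow> monomial_number 0 j = 0"
  by (simp add: monomial_number_def binomial_eq_0)

lemma monomial_number_1: "monomial_number e 1 = e"
  by (simp add: monomial_number_def)

text \<open>Pascal's rule: a monomial avoids a fixed variable or is divisible by it. For
  \<open>e = 0\<close> all terms vanish, so truncated subtraction is harmless.\<close>

lemma monomial_number_Suc:
  "1 \<le> j \<Longrightarrow> monomial_number e (Suc j) = monomial_number (e - 1) (Suc j) + monomial_number e j"
proof (cases e)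
  case (Suc n)
  assume "1 \<le> j"
  then show ?thesis using binomial_Suc_Suc[of "n + j" j]
    by (simp add: monomial_number_def Suc)
qed (simp add: monomial_number_0)

lemma card_link:
  assumes "finite F"
  shows "card F = card {v \<in> F. x \<notin># v} + card (link x F)" and "finite (link x F)"
proof -
  have eq: "add_mset x ` link x F = {v \<in> F. x \<in># v}"
    by (auto simp: link_def image_iff dest: multi_member_split)
  have inj: "inj_on (add_mset x) (link x F)" by (auto simp: inj_on_def)
  then have c: "card (link x F) = card {v \<in> F. x \<in># v}"
    using card_image[OF inj] by (simp add: eq)
  show "finite (link x F)"
    using finite_image_iff[OF inj] assms eq by simp
  have "card F = card ({v \<in> F. x \<notin># v} \<union> {v \<in> F. x \<in># v})"
    by (rule arg_cong[where f = card]) auto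
  also have "\<dots> = card {v \<in> F. x \<notin># v} + card {v \<in> F. x \<in># v}"
    using assms by (intro card_Un_disjoint) auto
  finally show "card F = card {v \<in> F. x \<notin># v} + card (link x F)" by (simp add: c)
qed

lemma stable_link: "shift_stable x F \<Longrightarrow> shift_stable x (link x F)"
  unfolding shift_stable_def link_def
proof (intro ballI)
  fix v y assume F: "\<forall>v\<in>F. \<forall>y\<in>#v. add_mset x (v - {#y#}) \<in> F" and v: "v \<in> {w. add_mset x w \<in> F}" "y \<in># v"
  then have "add_mset x (add_mset x v - {#y#}) \<in> F" by auto
  moreover have "add_mset x v - {#y#} = add_mset x (v - {#y#})" using v by (simp add: insert_DiffM2)
  ultimately show "add_mset x (v - {#y#}) \<in> {w. add_mset x w \<in> F}" by simp
qed

lemma stable_shadow: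
  assumes "shift_stable x F"
  shows "shift_stable x (shadow F)"
  unfolding shift_stable_def
proof (intro ballI)
  fix w y assume "w \<in> shadow F" "y \<in># w"
  then obtain v z where v: "v \<in> F" "z \<in># v" "w = v - {#z#}" by (auto simp: shadow_def)
  then obtain w' where w': "w = add_mset y w'" using \<open>y \<in># w\<close> by (auto dest: multi_member_split)
  then have v': "v = add_mset z (add_mset y w')" using v by (metis insert_DiffM)
  have "add_mset x (v - {#y#}) \<in> F" using assms v v' by (auto simp: shift_stable_def)
  moreover have "add_mset x (v - {#y#}) = add_mset z (add_mset x w')" using v' by (simp add: add_mset_commute)
  ultimately have "add_mset z (add_mset x w') - {#z#} \<in> shadow F" by (intro shadowI) auto
  then show "add_mset x (w - {#y#}) \<in> shadow F" by (simp add: w')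
qed

text \<open>
  A stable family shrinks, on omitting the variable \<open>x\<close>, as under restriction to a generic
  hyperplane in Green's theorem.
\<close>

lemma green_bound:
  assumes X: "finite X" "x \<notin> X"
    and macaulay: "\<And>d U e. 1 \<le> d \<Longrightarrow> U \<subseteq> multisets_of_size X (Suc d) \<Longrightarrow>
      card (shadow U) \<le> (\<Sum>j=1..d. monomial_number (e j) j) \<Longrightarrow>
      card U \<le> (\<Sum>j=1..d. monomial_number (e j) (Suc j))"
    and d: "1 \<le> d" and Q: "Q \<subseteq> multisets_of_size (insert x X) d" "shift_stable x Q"
    and card: "card Q \<le> (\<Sum>j=1..d. monomial_number (e j) j)"
  shows "card {v \<in> Q. x \<notin># v} \<le> (\<Sum>j=1..d. monomial_number (e j - 1) j)"
  using d Q card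
proof (induction d arbitrary: Q e rule: nat_induct_at_least)
  case base
  have finQ: "finite Q" using base X by (meson finite_insert finite_multisets_of_size finite_subset)
  show ?case
  proof (cases "Q = {}")
    case False
    then obtain v where v: "v \<in> Q" by auto
    then have "size v = 1" using base by (auto simp: multisets_of_size_def)
    then obtain y where y: "v = {#y#}" using size_1_singleton_mset by auto
    \<comment> \<open>In degree one, stability puts \<open>x\<close> itself into a nonempty
      \<open>Q\<close>, so omitting \<open>x\<close> loses at least one member.\<close>
    then have "add_mset x (v - {#y#}) \<in> Q"
      using base(2) v unfolding shift_stable_def by (metis union_single_eq_member)
    then have "{#x#} \<in> Q" using y by simp
    moreover have "{#x#} \<notin> {v \<in> Q. x \<notin># v}" by simp
    ultimately have "{v \<in> Q. x \<notin># v} \<subset> Q" by blast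
    then have "card {v \<in> Q. x \<notin># v} < card Q" using finQ by (simp add: psubset_card_mono)
    then show ?thesis using base by (simp add: monomial_number_def)
  qed auto
next
  case (Suc d)
  have finQ: "finite Q" using Suc X by (meson finite_insert finite_multisets_of_size finite_subset)
  let ?Q0 = "{v \<in> Q. x \<notin># v}" and ?Q1 = "{v \<in> link x Q. x \<notin># v}"
  show ?case
  \<comment> \<open>If \<open>?Q0\<close> is too large, the link is small, and induction bounds its
    part \<open>?Q1\<close> free of \<open>x\<close>. By stability \<open>?Q1\<close> contains the
    shadow of \<open>?Q0\<close>, so Macaulay's theorem in \<open>X\<close> bounds
    \<open>?Q0\<close> after all.\<close>
  proof (rule ccontr)
    assume neg: "\<not> ?case"
    have pascal: "monomial_number (e (Suc j)) (Suc j) =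
        monomial_number (e (Suc j) - 1) (Suc j) + monomial_number (e (Suc j)) j" if "1 \<le> j" for j
      using that by (rule monomial_number_Suc)
    have sh: "(\<Sum>j=1..Suc d. f j) = f 1 + (\<Sum>j=1..d. f (Suc j))" for f :: "nat \<Rightarrow> nat"
      by (subst sum.atLeast_Suc_atMost) (simp_all add: sum.shift_bounds_cl_Suc_ivl del: sum.cl_ivl_Suc)
    have "(\<Sum>j=1..d. monomial_number (e (Suc j)) (Suc j)) =
        (\<Sum>j=1..d. monomial_number (e (Suc j) - 1) (Suc j)) + (\<Sum>j=1..d. monomial_number (e (Suc j)) j)"
      using pascal by (simp add: sum.distrib)
    \<comment> \<open>The strict inequality in \<open>neg\<close> absorbs the difference between
      \<open>e 1\<close> and \<open>e 1 - 1\<close>.\<close>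
    then have link: "card (link x Q) \<le> (\<Sum>j=1..d. monomial_number (e (Suc j)) j)"
      using neg Suc.prems(3) card_link(1)[OF finQ, of x] monomial_number_1[of "e 1"]
        monomial_number_1[of "e 1 - 1"]
      unfolding sh by linarith
    have "link x Q \<subseteq> multisets_of_size (insert x X) d"
      using Suc.prems(1) by (fastforce simp: link_def multisets_of_size_def)
    then have "card ?Q1 \<le> (\<Sum>j=1..d. monomial_number (e (Suc j) - 1) j)"
      using Suc.IH[of "link x Q" "\<lambda>j. e (Suc j)"] link stable_link[OF Suc.prems(2)] by blast
    moreover have "card (shadow ?Q0) \<le> card ?Q1"
    proof (rule card_mono)
      show "finite ?Q1" using card_link(2)[OF finQ] by simp
      show "shadow ?Q0 \<subseteq> ?Q1"
        using Suc.prems(2) by (auto simp: shadow_def link_def shift_stable_def dest: in_diffD)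
    qed
    moreover have "?Q0 \<subseteq> multisets_of_size X (Suc d)"
      using Suc.prems(1) by (auto simp: multisets_of_size_def)
    ultimately have "card ?Q0 \<le> (\<Sum>j=1..d. monomial_number (e (Suc j) - 1) (Suc j))"
      using macaulay[of d ?Q0 "\<lambda>j. e (Suc j) - 1"] Suc.hyps by fastforce
    then show False using neg unfolding sh by linarith
  qed
qed

text \<open>Induction on the variables for a stable \<open>W\<close>. Its link lies in the shadow;
  its part free of \<open>x\<close> has shadow inside the part of \<open>shadow W\<close> free of
  \<open>x\<close>, which Green's bound controls. Pascal's rule recombines both. Arbitrary
  \<open>e\<close> lets the induction pass to \<open>e j - 1\<close>.\<close>

lemma macaulay_bound:
  assumes "finite X" "1 \<le> d" "U \<subseteq> multisets_of_size X (Suc d)"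
    and "card (shadow U) \<le> (\<Sum>j=1..d. monomial_number (e j) j)"
  shows "card U \<le> (\<Sum>j=1..d. monomial_number (e j) (Suc j))"
  using assms
proof (induction X arbitrary: d U e rule: finite_induct)
  case empty
  then show ?case by auto
next
  case (insert x X)
  obtain W where W: "W \<subseteq> multisets_of_size (insert x X) (Suc d)" "card W = card U"
    "card (shadow W) \<le> card (shadow U)" "shift_stable x W"
    using exists_stable[of "insert x X" x U "Suc d"] insert by blast
  have finW: "finite W" using W insert.hyps by (meson finite_insert finite_multisets_of_size finite_subset)
  let ?Q = "shadow W" and ?W0 = "{v \<in> W. x \<notin># v}"
  have finQ: "finite ?Q" using finW by (rule finite_shadow)
  have Q: "card ?Q \<le> (\<Sum>j=1..d. monomial_number (e j) j)" using W insert.prems by simp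
  have "card {v \<in> ?Q. x \<notin># v} \<le> (\<Sum>j=1..d. monomial_number (e j - 1) j)"
    using insert.hyps insert.IH insert.prems(1) shadow_multisets_of_size[OF W(1)] stable_shadow[OF W(4)] Q
    by (rule green_bound)
  moreover have "card (shadow ?W0) \<le> card {v \<in> ?Q. x \<notin># v}"
    using finQ by (intro card_mono) (auto simp: shadow_def dest: in_diffD)
  moreover have "?W0 \<subseteq> multisets_of_size X (Suc d)"
    using W(1) by (auto simp: multisets_of_size_def)
  ultimately have "card ?W0 \<le> (\<Sum>j=1..d. monomial_number (e j - 1) (Suc j))"
    using insert.IH[of d ?W0 "\<lambda>j. e j - 1"] insert.prems(1) by fastforce
  moreover have "card (link x W) \<le> card ?Q"
  proof (rule card_mono[OF finQ])
    show "link x W \<subseteq> ?Q"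
      using shadowI[of "add_mset x _" W x] by (auto simp: link_def)
  qed
  ultimately have "card U \<le> (\<Sum>j=1..d. monomial_number (e j - 1) (Suc j)) + (\<Sum>j=1..d. monomial_number (e j) j)"
    using card_link(1)[OF finW, of x] W(2) Q by linarith
  also have "\<dots> = (\<Sum>j=1..d. monomial_number (e j) (Suc j))"
    unfolding sum.distrib[symmetric]
    by (intro sum.cong refl monomial_number_Suc[symmetric]) simp
  finally show ?case .
qed

lemma binomial_expansion_macaulay:
  assumes a: "binomial_expansion i (int a) r n" "card (shadow U) \<le> a"
    and X: "finite X" and U: "U \<subseteq> multisets_of_size X (Suc i)"
  shows "card U \<le> (\<Sum>j=r..i. (n j + 1) choose (j + 1))"
proof -
  define e where "e j = (if j < r then 0 else n j + 1 - j)" for j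
  have r: "1 \<le> r" "r \<le> i" "r \<le> n r" and mono: "\<forall>j\<in>{r..<i}. n j < n (Suc j)"
    and "int a = int (\<Sum>j=r..i. n j choose j)"
    using a(1) unfolding binomial_expansion_def by blast+
  then have sum: "a = (\<Sum>j=r..i. n j choose j)" by (simp only: of_nat_eq_iff)
  \<comment> \<open>This makes the truncated subtraction in \<open>e\<close> exact from
    \<open>r\<close> on.\<close>
  have ge: "j \<le> n j" if "r \<le> j" "j \<le> i" for j
    using that
  proof (induction j rule: dec_induct)
    case (step j)
    then have "n j < n (Suc j)" using mono by simp
    then show ?case using step by simp
  qed (use r in auto)
  have e: "monomial_number (e j) j = n j choose j"
    "monomial_number (e j) (Suc j) = (n j + 1) choose (j + 1)" if "r \<le> j" "j \<le> i" for j
    using that ge[OF that] by (simp_all add: monomial_number_def e_def)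
  have "(\<Sum>j=r..i. n j choose j) = (\<Sum>j=r..i. monomial_number (e j) j)"
    using e by simp
  also have "\<dots> = (\<Sum>j=1..i. monomial_number (e j) j)"
    using r by (intro sum.mono_neutral_left) (auto simp: e_def monomial_number_0)
  finally have "card U \<le> (\<Sum>j=1..i. monomial_number (e j) (Suc j))"
    using r sum a(2) by (intro macaulay_bound[OF X _ U]) auto
  also have "\<dots> = (\<Sum>j=r..i. monomial_number (e j) (Suc j))"
    using r by (intro sum.mono_neutral_right) (auto simp: e_def monomial_number_0)
  also have "\<dots> = (\<Sum>j=r..i. (n j + 1) choose (j + 1))"
    using e by simp
  finally show ?thesis .
qed

subsection \<open>Order ideals generated in one degree\<close>

text \<open>Gaussian elimination: equation \<open>t\<close> eliminates an unknown \<open>s0\<close>.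
  Dimension comparisons below are made by counting equations and unknowns.\<close>

lemma exists_nonzero_solution:
  fixes a :: "'t \<Rightarrow> 's \<Rightarrow> real"
  assumes "finite T" "finite S" "card T < card S"
  shows "\<exists>f. (\<exists>s\<in>S. f s \<noteq> 0) \<and> (\<forall>t\<in>T. (\<Sum>s\<in>S. a t s * f s) = 0)"
  using assms
proof (induction T arbitrary: S a rule: finite_induct)
  case empty
  then have "S \<noteq> {}" by auto
  then show ?case by (intro exI[of _ "\<lambda>_. 1"]) auto
next
  case (insert t T)
  show ?case
  proof (cases "\<forall>s\<in>S. a t s = 0")
    case True
    obtain f where f: "\<exists>s\<in>S. f s \<noteq> 0" "\<forall>t\<in>T. (\<Sum>s\<in>S. a t s * f s) = 0"
      using insert.IH[of S a] insert.prems insert.hyps by auto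
    then show ?thesis using True by (intro exI[of _ f]) auto
  next
    case False
    then obtain s0 where s0: "s0 \<in> S" "a t s0 \<noteq> 0" by blast
    define S' where "S' = S - {s0}"
    have S': "finite S'" "card T < card S'"
      using insert s0 by (auto simp: S'_def)
    obtain f where f: "\<exists>s\<in>S'. f s \<noteq> 0"
      and f0: "\<And>t'. t' \<in> T \<Longrightarrow> (\<Sum>s\<in>S'. (a t' s - a t' s0 * a t s / a t s0) * f s) = 0"
      using insert.IH[OF S', of "\<lambda>t' s. a t' s - a t' s0 * a t s / a t s0"] by auto
    \<comment> \<open>The eliminated unknown takes the value forced by equation
      \<open>t\<close>.\<close>
    define g where "g = f(s0 := - (\<Sum>s\<in>S'. a t s * f s) / a t s0)"
    have split: "(\<Sum>s\<in>S. a t' s * g s) =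
        (\<Sum>s\<in>S'. a t' s * f s) - a t' s0 * (\<Sum>s\<in>S'. a t s * f s) / a t s0" for t'
    proof -
      have "(\<Sum>s\<in>S. a t' s * g s) = a t' s0 * g s0 + (\<Sum>s\<in>S'. a t' s * g s)"
        unfolding S'_def using s0 insert.prems by (intro sum.remove) auto
      also have "(\<Sum>s\<in>S'. a t' s * g s) = (\<Sum>s\<in>S'. a t' s * f s)"
        by (intro sum.cong) (auto simp: g_def S'_def)
      finally show ?thesis by (simp add: g_def)
    qed
    have "(\<Sum>s\<in>S. a t' s * g s) = 0" if "t' \<in> T" for t'
      using f0[OF that] unfolding split
      by (simp add: left_diff_distrib sum_subtractf sum_distrib_left sum_divide_distrib mult.assoc)
    moreover have "(\<Sum>s\<in>S. a t s * g s) = 0"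
      unfolding split using s0 by simp
    moreover have "\<exists>s\<in>S. g s \<noteq> 0"
      using f by (auto simp: g_def S'_def)
    ultimately show ?thesis by (intro exI[of _ g]) auto
  qed
qed

section \<open>Monotonicity in order ideals\<close>

definition ideal_part :: "'a multiset set \<Rightarrow> nat \<Rightarrow> 'a multiset set" where
  "ideal_part B d = {u. size u = d \<and> (\<exists>m\<in>B. u \<subseteq># m)}"

definition variables :: "'a multiset set \<Rightarrow> 'a set" where
  "variables B = (\<Union>m\<in>B. set_mset m)"

lemma finite_variables: "finite B \<Longrightarrow> finite (variables B)"
  by (simp add: variables_def)

lemma ideal_part_subset: "ideal_part B d \<subseteq> multisets_of_size (variables B) d"
  by (auto simp: ideal_part_def multisets_of_size_def variables_def dest: mset_subset_eqD)

lemma finite_ideal_part: "finite B \<Longrightarrow> finite (ideal_part B d)"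
  by (rule finite_subset[OF ideal_part_subset finite_multisets_of_size[OF finite_variables]])

lemma ideal_part_remove: "add_mset x u \<in> ideal_part B (Suc d) \<Longrightarrow> u \<in> ideal_part B d"
proof -
  assume "add_mset x u \<in> ideal_part B (Suc d)"
  then obtain m where m: "m \<in> B" "add_mset x u \<subseteq># m" "size u = d" by (auto simp: ideal_part_def)
  then have "u \<subseteq># m" by (meson mset_subset_eq_insertD subset_mset.less_imp_le)
  then show ?thesis using m by (auto simp: ideal_part_def)
qed

lemma ideal_part_variable: "v \<in> ideal_part B d \<Longrightarrow> x \<in># v \<Longrightarrow> x \<in> variables B"
  by (auto simp: ideal_part_def variables_def dest: mset_subset_eqD)

lemma raise_funpow_sum:
  "(raise ^^ p) (\<lambda>w. \<Sum>s\<in>S. c s * g s w) v = (\<Sum>s\<in>S. c s * (raise ^^ p) (g s) v)"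
proof (induction p arbitrary: v)
  case (Suc p)
  have "(raise ^^ Suc p) (\<lambda>w. \<Sum>s\<in>S. c s * g s w) v =
      (\<Sum>x\<in>set_mset v. \<Sum>s\<in>S. c s * (raise ^^ p) (g s) (v - {#x#}))"
    by (simp add: Suc raise_def[of "(raise ^^ p) (\<lambda>w. \<Sum>s\<in>S. c s * g s w)"])
  also have "\<dots> = (\<Sum>s\<in>S. c s * (\<Sum>x\<in>set_mset v. (raise ^^ p) (g s) (v - {#x#})))"
    by (subst sum.swap) (simp add: sum_distrib_left)
  also have "\<dots> = (\<Sum>s\<in>S. c s * (raise ^^ Suc p) (g s) v)"
    by (simp add: raise_def[of "(raise ^^ p) (g _)"])
  finally show ?case .
qed simp

text \<open>Each \<open>u\<close> divides some generator \<open>m\<close>, and the box of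
  \<open>m\<close> lies in the ideal, so the box result applies there.\<close>

lemma raise_funpow_inj:
  assumes "\<And>m. m \<in> B \<Longrightarrow> size m = k" "p + 2 * d \<le> k"
    and "\<And>v. v \<in> ideal_part B (d + p) \<Longrightarrow> (raise ^^ p) f v = 0"
    and u: "u \<in> ideal_part B d"
  shows "f u = 0"
proof -
  obtain m where m: "m \<in> B" "u \<subseteq># m" "size u = d" using u by (auto simp: ideal_part_def)
  show ?thesis
    by (rule raise_funpow_inj_box[of p d m])
       (use m assms in \<open>auto simp: ideal_part_def\<close>)
qed

text \<open>Too few monomials in degree \<open>j\<close> would give \<open>raise ^^ (j - i)\<close>
  a nonzero kernel vector. Injectivity forbids this, since
  \<open>(j - i) + 2 * i = i + j \<le> k\<close>.\<close>

lemma card_ideal_part_le: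
  assumes B: "finite B" "\<And>m. m \<in> B \<Longrightarrow> size m = k" and ij: "i \<le> j" "i + j \<le> k"
  shows "card (ideal_part B i) \<le> card (ideal_part B j)"
proof (rule ccontr)
  let ?S = "ideal_part B i" and ?T = "ideal_part B j"
  let ?e = "\<lambda>u w. if w = u then 1 else 0 :: real"
  assume "\<not> ?thesis"
  then obtain f where f: "\<exists>u\<in>?S. f u \<noteq> 0"
    and f0: "\<And>v. v \<in> ?T \<Longrightarrow> (\<Sum>u\<in>?S. (raise ^^ (j - i)) (?e u) v * f u) = 0"
    using exists_nonzero_solution[of ?T ?S "\<lambda>v u. (raise ^^ (j - i)) (?e u) v"] finite_ideal_part[OF B(1)]
    by auto
  define g where "g w = (\<Sum>u\<in>?S. f u * ?e u w)" for w
  have g: "g w = (if w \<in> ?S then f w else 0)" for w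
    using finite_ideal_part[OF B(1), of i] by (simp add: g_def if_distrib cong: if_cong)
  have g0: "(raise ^^ (j - i)) g v = 0" if "v \<in> ?T" for v
    using f0[OF that] raise_funpow_sum[of "j - i" f ?e ?S v] unfolding g_def by (simp add: mult.commute)
  have "g u = 0" if "u \<in> ?S" for u
    by (rule raise_funpow_inj[where B = B and k = k and p = "j - i" and d = i]) (use that ij B(2) g0 in auto)
  then show False using f g by auto
qed

section \<open>Harmonic functions and their leading monomials\<close>

text \<open>The kernel of the adjoint of \<open>raise\<close> for the standard inner product.
  Vanishing off the ideal lets the sum run over all variables.\<close>

definition harmonics :: "'a multiset set \<Rightarrow> nat \<Rightarrow> ('a multiset \<Rightarrow> real) set" where
  "harmonics B d = {g. (\<forall>v. v \<notin> ideal_part B d \<longrightarrow> g v = 0) \<and>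
     (\<forall>u. (\<Sum>x\<in>variables B. g (add_mset x u)) = 0)}"

text \<open>
  Leading monomials for the multiset order. Contracting a harmonic function by a variable keeps it
  harmonic and divides its leading monomial by that variable, so the pivots form an order ideal.
\<close>

definition pivots :: "'a::linorder multiset set \<Rightarrow> nat \<Rightarrow> 'a multiset set" where
  "pivots B d = {v. \<exists>g\<in>harmonics B d. g v \<noteq> 0 \<and> (\<forall>w>v. g w = 0)}"

lemma pivots_subset: "pivots B d \<subseteq> ideal_part B d"
  by (auto simp: pivots_def harmonics_def)

lemma shadow_pivots: "shadow (pivots B (Suc d)) \<subseteq> pivots B d"
proof
  fix u assume "u \<in> shadow (pivots B (Suc d))"
  then obtain v x where v: "v \<in> pivots B (Suc d)" "x \<in># v" "u = v - {#x#}"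
    by (auto simp: shadow_def)
  then have vu: "v = add_mset x u" by simp
  obtain g where g: "g \<in> harmonics B (Suc d)" "g v \<noteq> 0" "\<And>w. w > v \<Longrightarrow> g w = 0"
    using v(1) by (auto simp: pivots_def)
  let ?g = "\<lambda>w. g (add_mset x w)"
  have "(\<Sum>y\<in>variables B. g (add_mset x (add_mset y w))) = 0" for w
    using g(1) by (simp add: harmonics_def add_mset_commute[of x])
  moreover have "?g w = 0" if "w \<notin> ideal_part B d" for w
    using that g(1) ideal_part_remove[of x w B d] by (auto simp: harmonics_def)
  ultimately have "?g \<in> harmonics B d" by (simp add: harmonics_def)
  \<comment> \<open>Multiplication by \<open>x\<close> is strictly monotone in the multiset
    order.\<close>
  moreover have "?g w = 0" if "w > u" for w
    using that g(3)[of "add_mset x w"] by (simp add: vu)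
  moreover have "?g u \<noteq> 0" using g(2) vu by simp
  ultimately show "u \<in> pivots B d" by (auto simp: pivots_def)
qed

lemma exists_pivot:
  assumes B: "finite B" and g: "g \<in> harmonics B d" "g v \<noteq> 0"
  shows "\<exists>p\<in>pivots B d. g p \<noteq> 0"
proof -
  let ?Z = "{w. g w \<noteq> 0}"
  have "?Z \<subseteq> ideal_part B d" using g by (auto simp: harmonics_def)
  then have fin: "finite ?Z" using finite_ideal_part[OF B] finite_subset by blast
  define p where "p = Max ?Z"
  have p: "g p \<noteq> 0" using Max_in[OF fin] g(2) by (auto simp: p_def)
  have "g w = 0" if "w > p" for w
    using that Max_ge[OF fin, of w] by (force simp: p_def not_le[symmetric])
  then have "p \<in> pivots B d" using g(1) p unfolding pivots_def by blast
  with p show ?thesis by blast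
qed

text \<open>Harmonicity gives one equation per monomial of degree \<open>d\<close>, vanishing on the
  pivots one per pivot. With fewer equations than unknowns, a nonzero harmonic function would vanish
  at its own leading monomial.\<close>

lemma card_pivots_ge:
  assumes B: "finite B"
  shows "card (ideal_part B (Suc d)) \<le> card (pivots B (Suc d)) + card (ideal_part B d)"
proof (rule ccontr)
  let ?S = "ideal_part B (Suc d)" and ?P = "pivots B (Suc d)" and ?R = "ideal_part B d"
  have finS: "finite ?S" and finR: "finite ?R" using finite_ideal_part[OF B] by auto
  have finP: "finite ?P" using finS pivots_subset finite_subset by blast
  define a where "a t v = (case t of Inl p \<Rightarrow> if v = p then 1 else 0
     | Inr u \<Rightarrow> (\<Sum>x\<in>variables B. if v = add_mset x u then 1 else 0 :: real))" for t v
  assume "\<not> ?thesis"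
  then have "card (?P <+> ?R) < card ?S" using finP finR by (simp add: card_Plus)
  then obtain f where f: "\<exists>v\<in>?S. f v \<noteq> 0"
    and f0: "\<And>t. t \<in> ?P <+> ?R \<Longrightarrow> (\<Sum>v\<in>?S. a t v * f v) = 0"
    using exists_nonzero_solution[of "?P <+> ?R" ?S a] finP finR finS by auto
  define g where "g v = (if v \<in> ?S then f v else 0)" for v
  have "(\<Sum>x\<in>variables B. g (add_mset x u)) = 0" for u
  proof (cases "u \<in> ?R")
    case True
    have "(\<Sum>x\<in>variables B. g (add_mset x u)) =
        (\<Sum>x\<in>variables B. \<Sum>v\<in>?S. if v = add_mset x u then f v else 0)"
      using finS by (simp add: g_def)
    also have "\<dots> = (\<Sum>v\<in>?S. a (Inr u) v * f v)"
      by (subst sum.swap) (auto simp: a_def sum_distrib_right intro!: sum.cong)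
    also have "\<dots> = 0" using f0[of "Inr u"] True by auto
    finally show ?thesis .
  next
    case False
    then show ?thesis using ideal_part_remove[of _ u B d] by (intro sum.neutral) (auto simp: g_def)
  qed
  then have g: "g \<in> harmonics B (Suc d)" by (simp add: harmonics_def g_def)
  have "g p = 0" if "p \<in> ?P" for p
  proof -
    have "(\<Sum>v\<in>?S. a (Inl p) v * f v) = (\<Sum>v\<in>?S. if v = p then f v else 0)"
      by (intro sum.cong) (auto simp: a_def)
    also have "\<dots> = g p" using finS by (simp add: g_def)
    finally show ?thesis using f0[of "Inl p"] that by auto
  qed
  moreover obtain v where "g v \<noteq> 0" using f unfolding g_def by metis
  ultimately show False using exists_pivot[OF B g] by blast
qed

text \<open>Both sides sum over pairs of \<open>u\<close> and \<open>x\<close>; products outside the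
  ideal contribute nothing because \<open>H\<close> vanishes there.\<close>

lemma sum_raise_adjoint:
  assumes B: "finite B" and H: "\<And>v. v \<notin> ideal_part B (Suc d) \<Longrightarrow> H v = 0"
  shows "(\<Sum>v\<in>ideal_part B (Suc d). H v * raise b v) =
    (\<Sum>u\<in>ideal_part B d. b u * (\<Sum>x\<in>variables B. H (add_mset x u)))"
proof -
  let ?S = "ideal_part B (Suc d)" and ?R = "ideal_part B d" and ?X = "variables B"
  have finS: "finite ?S" and finR: "finite ?R" and finX: "finite ?X"
    using finite_ideal_part[OF B] finite_variables[OF B] by auto
  have "(\<Sum>v\<in>?S. H v * raise b v) = (\<Sum>v\<in>?S. \<Sum>x\<in>?X. if x \<in># v then H v * b (v - {#x#}) else 0)"
  proof (rule sum.cong[OF refl])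
    fix v assume v: "v \<in> ?S"
    have "{x \<in> ?X. x \<in># v} = set_mset v" using ideal_part_variable[OF v] by auto
    then show "H v * raise b v = (\<Sum>x\<in>?X. if x \<in># v then H v * b (v - {#x#}) else 0)"
      using finX by (simp add: raise_def sum_distrib_left sum.inter_filter[symmetric])
  qed
  also have "\<dots> = (\<Sum>x\<in>?X. \<Sum>v\<in>{v \<in> ?S. x \<in># v}. H v * b (v - {#x#}))"
    using finS by (subst sum.swap) (simp add: sum.inter_filter)
  also have "\<dots> = (\<Sum>x\<in>?X. \<Sum>u\<in>?R. b u * H (add_mset x u))"
  proof (rule sum.cong[OF refl])
    fix x
    have "(\<Sum>v\<in>{v \<in> ?S. x \<in># v}. H v * b (v - {#x#})) =
        (\<Sum>u\<in>{u \<in> ?R. add_mset x u \<in> ?S}. b u * H (add_mset x u))"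
      by (rule sum.reindex_bij_witness[of _ "add_mset x" "\<lambda>v. v - {#x#}"])
         (auto intro: ideal_part_remove[of x])
    also have "\<dots> = (\<Sum>u\<in>?R. b u * H (add_mset x u))"
      using finR H by (intro sum.mono_neutral_left) auto
    finally show "(\<Sum>v\<in>{v \<in> ?S. x \<in># v}. H v * b (v - {#x#})) = \<dots>" .
  qed
  also have "\<dots> = (\<Sum>u\<in>?R. b u * (\<Sum>x\<in>?X. H (add_mset x u)))"
    by (subst sum.swap) (simp add: sum_distrib_left)
  finally show ?thesis .
qed

text \<open>Harmonic functions with distinct leading monomials and the images under
  \<open>raise\<close> of indicator functions are linearly independent: the two spans are
  orthogonal, the first family is triangular, and \<open>raise\<close> is injective in degree
  \<open>d\<close> because \<open>1 + 2 * d \<le> k\<close>.\<close>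

lemma card_pivots_le:
  assumes B: "finite B" "\<And>m. m \<in> B \<Longrightarrow> size m = k" and d: "2 * d + 1 \<le> k"
  shows "card (pivots B (Suc d)) + card (ideal_part B d) \<le> card (ideal_part B (Suc d))"
proof (rule ccontr)
  let ?S = "ideal_part B (Suc d)" and ?P = "pivots B (Suc d)" and ?R = "ideal_part B d"
  let ?e = "\<lambda>u w. if w = u then 1 else 0 :: real"
  have finS: "finite ?S" and finR: "finite ?R" using finite_ideal_part[OF B(1)] by auto
  have finP: "finite ?P" using finS pivots_subset finite_subset by blast
  have "\<forall>p\<in>?P. \<exists>g. g \<in> harmonics B (Suc d) \<and> g p \<noteq> 0 \<and> (\<forall>w>p. g w = 0)"
    by (auto simp: pivots_def)
  then obtain G where G: "\<And>p. p \<in> ?P \<Longrightarrow> G p \<in> harmonics B (Suc d)"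
    "\<And>p. p \<in> ?P \<Longrightarrow> G p p \<noteq> 0" "\<And>p w. p \<in> ?P \<Longrightarrow> w > p \<Longrightarrow> G p w = 0"
    by metis
  define a where "a v s = (case s of Inl p \<Rightarrow> G p v | Inr u \<Rightarrow> raise (?e u) v)" for v s
  assume "\<not> ?thesis"
  then have "card ?S < card (?P <+> ?R)" using finP finR by (simp add: card_Plus)
  then obtain f where f: "\<exists>s\<in>?P <+> ?R. f s \<noteq> 0"
    and f0: "\<And>v. v \<in> ?S \<Longrightarrow> (\<Sum>s\<in>?P <+> ?R. a v s * f s) = 0"
    using exists_nonzero_solution[of ?S "?P <+> ?R" a] finP finR finS by auto
  define H where "H v = (\<Sum>p\<in>?P. f (Inl p) * G p v)" for v
  define b where "b w = (\<Sum>u\<in>?R. f (Inr u) * ?e u w)" for w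
  have b: "b w = (if w \<in> ?R then f (Inr w) else 0)" for w
    using finR by (simp add: b_def if_distrib cong: if_cong)
  have Hb: "H v + raise b v = 0" if "v \<in> ?S" for v
  proof -
    have "raise b v = (\<Sum>u\<in>?R. f (Inr u) * raise (?e u) v)"
      using raise_funpow_sum[of 1 "\<lambda>u. f (Inr u)" ?e ?R v] by (simp add: b_def[abs_def])
    then show ?thesis using f0[OF that] finP finR
      by (simp add: sum.Plus a_def H_def mult.commute)
  qed
  have H0: "H v = 0" if "v \<notin> ?S" for v
    using G(1) that by (auto simp: H_def harmonics_def intro!: sum.neutral)
  have H_sum: "(\<Sum>x\<in>variables B. H (add_mset x u)) = 0" for u
  proof -
    have "(\<Sum>x\<in>variables B. H (add_mset x u)) =
        (\<Sum>p\<in>?P. f (Inl p) * (\<Sum>x\<in>variables B. G p (add_mset x u)))"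
      unfolding H_def by (subst sum.swap) (simp add: sum_distrib_left)
    also have "\<dots> = 0" using G(1) by (intro sum.neutral) (auto simp: harmonics_def)
    finally show ?thesis .
  qed
  \<comment> \<open>Harmonic functions are orthogonal to the image of \<open>raise\<close>, so \<open>H = - raise b\<close> has norm \<open>0\<close>.\<close>
  have "(\<Sum>v\<in>?S. H v * H v) = - (\<Sum>v\<in>?S. H v * raise b v)"
    unfolding sum_negf[symmetric]
  proof (rule sum.cong[OF refl])
    fix v assume "v \<in> ?S"
    then have "H v = - raise b v" using Hb by (simp add: eq_neg_iff_add_eq_0)
    then show "H v * H v = - (H v * raise b v)" by simp
  qed
  also have "\<dots> = 0" using sum_raise_adjoint[OF B(1), of d H b] H0 H_sum by simp
  finally have HS: "H v = 0" if "v \<in> ?S" for v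
    using that finS by (simp add: sum_nonneg_eq_0_iff)
  have "f (Inl p) = 0" if "p \<in> ?P" for p
  proof (rule ccontr)
    \<comment> \<open>At the largest pivot \<open>q\<close> with nonzero coefficient, smaller pivots
      contribute nothing because \<open>G r\<close> vanishes above \<open>r\<close>.\<close>
    let ?Z = "{p \<in> ?P. f (Inl p) \<noteq> 0}"
    assume "f (Inl p) \<noteq> 0"
    then have q: "Max ?Z \<in> ?Z" using finP that by (intro Max_in) auto
    define q where "q = Max ?Z"
    have qZ: "q \<in> ?Z" using q by (simp only: q_def)
    have "f (Inl r) * G r q = 0" if "r \<in> ?P" "r \<noteq> q" for r
    proof (cases "r < q")
      case True
      then show ?thesis using G(3)[OF that(1)] by simp
    next
      case False
      then have "q < r" using that by simp
      then have "r \<notin> ?Z" using finP Max_ge[of ?Z r] by (auto simp: q_def not_le[symmetric])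
      then show ?thesis using that by simp
    qed
    then have "H q = f (Inl q) * G q q"
      unfolding H_def using finP qZ by (subst sum.remove[of _ q]) (simp_all add: sum.neutral)
    moreover have "H q = 0" using HS H0 by blast
    ultimately show False using qZ G(2)[of q] by auto
  qed
  moreover have "f (Inr u) = 0" if "u \<in> ?R" for u
  proof -
    have b0: "(raise ^^ 1) b v = 0" if "v \<in> ideal_part B (d + 1)" for v
      using Hb[of v] HS[of v] that by simp
    have "b u = 0"
      by (rule raise_funpow_inj[where B = B and k = k and p = 1 and d = d]) (use that d B(2) b0 in auto)
    then show ?thesis using that b by simp
  qed
  ultimately show False using f by auto
qed

section \<open>Inequalities for pure O-sequences\<close>

lemma pure_O_sequence_consequences:
  assumes h0: "h 0 = 1" and h: "pure_O_sequence k h"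
  shows "(\<forall>i j. i \<le> j \<and> i + j \<le> k \<longrightarrow> h i \<le> h j) \<and> g_inequalities k h"
proof -
  obtain m :: "nat \<Rightarrow> nat multiset" where hk: "0 < h k"
    and m: "\<And>i. i \<in> {1..nat (h k)} \<Longrightarrow> m i \<in> monomials (nat (h 1)) k"
    and card: "\<And>l. l \<in> {1..k} \<Longrightarrow>
      h l = int (card {u \<in> monomials (nat (h 1)) l. \<exists>i\<in>{1..nat (h k)}. u \<subseteq># m i})"
    using h unfolding pure_O_sequence_def by blast
  define B where "B = m ` {1..nat (h k)}"
  have B: "finite B" "\<And>b. b \<in> B \<Longrightarrow> size b = k"
    using m by (auto simp: B_def monomials_def)
  have "{u \<in> monomials (nat (h 1)) l. \<exists>i\<in>{1..nat (h k)}. u \<subseteq># m i} = ideal_part B l" for l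
    using m by (fastforce simp: ideal_part_def B_def monomials_def dest: mset_subset_eqD)
  then have h_pos: "h l = int (card (ideal_part B l))" if "1 \<le> l" "l \<le> k" for l
    using card[of l] that by simp
  \<comment> \<open>\<open>pure_O_sequence\<close> starts in degree one; a generator, available as
    \<open>h k > 0\<close>, makes degree zero agree with \<open>h 0 = 1\<close>.\<close>
  have "m 1 \<in> B" using hk by (auto simp: B_def)
  then have "ideal_part B 0 = {{#}}" by (auto simp: ideal_part_def)
  then have h_eq: "h l = int (card (ideal_part B l))" if "l \<le> k" for l
    using h_pos[of l] h0 that by (cases "l = 0") auto
  have mono: "h i \<le> h j" if "i \<le> j" "i + j \<le> k" for i j
    using card_ideal_part_le[OF B, of i j] that h_eq[of i] h_eq[of j] by simp
  have g: "g_number h i = int (card (pivots B i))" if i: "1 \<le> i" "i \<le> k div 2" for i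
  proof -
    obtain d where d: "i = Suc d" using i by (cases i) auto
    have "card (ideal_part B (Suc d)) = card (pivots B (Suc d)) + card (ideal_part B d)"
      using card_pivots_ge[OF B(1), of d] card_pivots_le[OF B, of d] i d by fastforce
    then show ?thesis using i by (simp add: g_number_def d h_eq)
  qed
  have fin: "finite (pivots B i)" for i
    using finite_subset[OF pivots_subset finite_ideal_part[OF B(1)]] .
  have "g_number h (i + 1) \<le> int (\<Sum>j=r..i. (n j + 1) choose (j + 1))"
    if i: "i \<in> {1..<k div 2}" and e: "binomial_expansion i (g_number h i) r n" for i r n
  proof -
    have "card (pivots B (Suc i)) \<le> (\<Sum>j=r..i. (n j + 1) choose (j + 1))"
    proof (rule binomial_expansion_macaulay)
      show "binomial_expansion i (int (card (pivots B i))) r n" using e g[of i] i by simp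
      show "card (shadow (pivots B (Suc i))) \<le> card (pivots B i)"
        by (rule card_mono[OF fin shadow_pivots])
      show "finite (variables B)" by (rule finite_variables[OF B(1)])
      show "pivots B (Suc i) \<subseteq> multisets_of_size (variables B) (Suc i)"
        using pivots_subset ideal_part_subset by (rule order_trans)
    qed
    then show ?thesis using g[of "i + 1"] i by (simp del: of_nat_sum)
  qed
  \<comment> \<open>Zero has no binomial expansion; here an empty shadow forces the next pivots to
    be empty.\<close>
  moreover have "g_number h (i + 1) \<le> 0" if i: "i \<in> {1..<k div 2}" and "g_number h i = 0" for i
  proof -
    have "pivots B i = {}" using g[of i] fin[of i] that by simp
    then have sh: "shadow (pivots B (Suc i)) = {}" using shadow_pivots[of B i] by simp
    have "v \<notin> pivots B (Suc i)" for v
    proof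
      assume v: "v \<in> pivots B (Suc i)"
      then have "size v = Suc i" using pivots_subset by (fastforce simp: ideal_part_def)
      then obtain x where "x \<in># v" by (metis size_eq_Suc_imp_elem)
      then show False using shadowI[OF v] sh by blast
    qed
    then have "pivots B (Suc i) = {}" by blast
    then show ?thesis using g[of "i + 1"] i by simp
  qed
  moreover have "0 \<le> g_number h i" if "i \<in> {1..k div 2}" for i
    using g[of i] that by simp
  ultimately show ?thesis using mono unfolding g_inequalities_def by blast
qed

subsection \<open>Relabelling the vertices of a complex\<close>

text \<open>These invariants depend only on inclusions and cardinalities of faces. This transfers
  the conjecture from vertices in \<open>nat\<close> to any vertex type.\<close>

lemma image_faces:
  assumes f: "inj_on f V" and M: "M \<subseteq> Pow V"
  shows "F \<in> M \<Longrightarrow> face_dim (f ` F) = face_dim F"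
    and "complex_rank ((`) f ` M) = complex_rank M"
    and "facets ((`) f ` M) = (`) f ` facets M"
    and "pure_complex ((`) f ` M) \<longleftrightarrow> pure_complex M"
    and "h_number ((`) f ` M) = h_number M"
proof -
  show dim: "face_dim (f ` F) = face_dim F" if "F \<in> M" for F
    using that f M by (auto simp: face_dim_def card_image inj_on_subset)
  then have "face_dim ` (`) f ` M = face_dim ` M" by (simp add: image_image)
  then show rank: "complex_rank ((`) f ` M) = complex_rank M"
    by (simp only: complex_rank_def complex_dim_def)
  have sub: "f ` F \<subseteq> f ` G \<longleftrightarrow> F \<subseteq> G" if "F \<in> M" "G \<in> M" for F G
  proof -
    have "F \<subseteq> V" "G \<subseteq> V" using that M by auto
    then show ?thesis using f by (auto simp: inj_on_def subset_iff) blast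
  qed
  have eq: "f ` F = f ` G \<longleftrightarrow> F = G" if "F \<in> M" "G \<in> M" for F G
    using sub[OF that] sub[OF that(2,1)] by auto
  have max: "(\<forall>H\<in>(`) f ` M. f ` F \<subseteq> H \<longrightarrow> f ` F = H) \<longleftrightarrow> (\<forall>G\<in>M. F \<subseteq> G \<longrightarrow> F = G)"
    if "F \<in> M" for F
    using sub[OF that] eq[OF that] by (simp add: ball_simps)
  have "facets ((`) f ` M) = (`) f ` {F \<in> M. \<forall>H\<in>(`) f ` M. f ` F \<subseteq> H \<longrightarrow> f ` F = H}"
    unfolding facets_def by (rule set_eqI) (simp only: mem_Collect_eq image_iff Bex_def, metis)
  also have "{F \<in> M. \<forall>H\<in>(`) f ` M. f ` F \<subseteq> H \<longrightarrow> f ` F = H} = facets M"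
    unfolding facets_def by (rule Collect_cong) (simp only: max cong: conj_cong)
  finally show fac: "facets ((`) f ` M) = (`) f ` facets M" .
  have "F \<in> M" if "F \<in> facets M" for F using that unfolding facets_def by blast
  then show "pure_complex ((`) f ` M) \<longleftrightarrow> pure_complex M"
    unfolding pure_complex_def fac by (simp add: dim)
  have "f_number ((`) f ` M) i = f_number M i" for i
  proof -
    have "{F \<in> (`) f ` M. face_dim F = i} = (`) f ` {F \<in> M. face_dim F = i}"
      using dim by auto
    moreover have "inj_on ((`) f) {F \<in> M. face_dim F = i}"
      using eq by (auto simp: inj_on_def)
    ultimately show ?thesis by (simp add: f_number_def card_image)
  qed
  then show "h_number ((`) f ` M) = h_number M"
    by (simp add: h_number_def rank fun_eq_iff)
qed

lemma induced_subcomplex_image: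
  assumes f: "inj_on f V" and M: "M \<subseteq> Pow V" and W: "W \<subseteq> V"
  shows "induced_subcomplex ((`) f ` M) (f ` W) = (`) f ` induced_subcomplex M W"
proof -
  have "f ` F \<subseteq> f ` W \<longleftrightarrow> F \<subseteq> W" if "F \<in> M" for F
    using that M W inj_on_image_mem_iff[OF f] by blast
  then show ?thesis by (auto simp: induced_subcomplex_def)
qed

lemma matroid_complex_image:
  assumes f: "inj_on f V" and M: "matroid_complex V M"
  shows "matroid_complex (f ` V) ((`) f ` M)"
proof -
  have sc: "simplicial_complex V M" and pure: "\<And>W. W \<subseteq> V \<Longrightarrow> pure_complex (induced_subcomplex M W)"
    using M by (auto simp: matroid_complex_def)
  have MV: "M \<subseteq> Pow V" using sc by (simp add: simplicial_complex_def)
  have sub: "G \<in> (`) f ` M" if "F \<in> M" "G \<subseteq> f ` F" for F G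
    using that sc by (auto simp: subset_image_iff simplicial_complex_def)
  have "simplicial_complex (f ` V) ((`) f ` M)"
  proof -
    have "(`) f ` M \<subseteq> Pow (f ` V)" using MV by auto
    moreover have "f ` {} \<in> (`) f ` M" using sc by (intro imageI) (simp add: simplicial_complex_def)
    moreover have "{f x} \<in> (`) f ` M" if "x \<in> V" for x
    proof -
      have "f ` {x} \<in> (`) f ` M" using sc that by (intro imageI) (simp add: simplicial_complex_def)
      then show ?thesis by simp
    qed
    ultimately show ?thesis
      using sc sub unfolding simplicial_complex_def by simp
  qed
  moreover have "pure_complex (induced_subcomplex ((`) f ` M) W)" if W: "W \<subseteq> f ` V" for W
  proof -
    obtain W' where W': "W' \<subseteq> V" "W = f ` W'" using W by (auto simp: subset_image_iff)
    have "induced_subcomplex M W' \<subseteq> Pow V" using MV by (auto simp: induced_subcomplex_def)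
    then show ?thesis
      using image_faces(4)[OF f] pure[OF W'(1)] induced_subcomplex_image[OF f MV W'(1)] W'(2) by simp
  qed
  ultimately show ?thesis by (simp add: matroid_complex_def)
qed

lemma coloop_free_image:
  assumes f: "inj_on f V" and MV: "M \<subseteq> Pow V" and M: "coloop_free V M"
  shows "coloop_free (f ` V) ((`) f ` M)"
  unfolding coloop_free_def coloop_def
proof (intro notI, elim exE conjE)
  fix i
  assume i: "i \<in> f ` V"
    and lt: "complex_rank (induced_subcomplex ((`) f ` M) (f ` V - {i})) < complex_rank ((`) f ` M)"
  then obtain v where v: "v \<in> V" "i = f v" by auto
  have "f ` V - {i} = f ` (V - {v})" using f v by (auto simp: inj_on_def)
  then have "complex_rank (induced_subcomplex ((`) f ` M) (f ` V - {i})) =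
      complex_rank ((`) f ` induced_subcomplex M (V - {v}))"
    using induced_subcomplex_image[OF f MV, of "V - {v}"] by auto
  also have "\<dots> = complex_rank (induced_subcomplex M (V - {v}))"
    using MV by (intro image_faces(2)[OF f]) (auto simp: induced_subcomplex_def)
  finally have "coloop V M v"
    using lt v image_faces(2)[OF f MV] by (simp add: coloop_def)
  then show False using M by (auto simp: coloop_free_def)
qed

lemma h_number_0:
  assumes "simplicial_complex V M"
  shows "h_number M 0 = 1"
proof -
  \<comment> \<open>An infinite face would also have \<open>face_dim\<close> equal to
    \<open>-1\<close>, since its \<open>card\<close> is \<open>0\<close>.\<close>
  have "finite F" if "F \<in> M" for F
    using assms that by (meson PowD finite_subset simplicial_complex_def subsetD)
  moreover have "{} \<in> M" using assms by (simp add: simplicial_complex_def)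
  ultimately have "{F \<in> M. face_dim F = - 1} = {{}}"
    by (auto simp: face_dim_def)
  then show ?thesis by (simp add: h_number_def f_number_def)
qed

theorem corollary6p3:
  fixes V :: "'a set" and M :: "'a set set" and k :: nat
  assumes stanley:
    "\<And>d (W :: nat set) (N :: nat set set).
       \<lbrakk>1 \<le> d; matroid_complex W N; coloop_free W N; complex_rank N = d\<rbrakk>
       \<Longrightarrow> pure_O_sequence d (h_number N)"
  assumes "1 \<le> k" and "matroid_complex V M" and "coloop_free V M" and "complex_rank M = k"
  shows "(\<forall>i j. i \<le> j \<and> i + j \<le> k \<longrightarrow> h_number M i \<le> h_number M j) \<and>
         g_inequalities k (h_number M)"
proof -
  have sc: "simplicial_complex V M" using assms(3) by (simp add: matroid_complex_def)
  then have MV: "M \<subseteq> Pow V" and "finite V" by (auto simp: simplicial_complex_def)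
  then obtain f :: "'a \<Rightarrow> nat" where f: "inj_on f V"
    using finite_imp_inj_to_nat_seg by blast
  have "pure_O_sequence k (h_number ((`) f ` M))"
    using assms(2-5) matroid_complex_image[OF f] coloop_free_image[OF f MV] image_faces(2)[OF f MV]
    by (intro stanley[of k "f ` V"]) auto
  then have "pure_O_sequence k (h_number M)"
    by (simp only: image_faces(5)[OF f MV])
  then show ?thesis
    using pure_O_sequence_consequences[of "h_number M" k] h_number_0[OF sc] by blast
qed

end
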